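(* Let $G$ be a finite group with $G\in\mathcal{CD}(G)$. Let $p$ be a prime and $n\ge 2$ an integer, and suppose that the lattice $\mathcal{CD}(G)$ is isomorphic to $\mathcal{L}(E_{p^n})$. Then $G=P\times Q$, where $P$ is the Sylow $p$-subgroup of $G$, $P/Z(P)$ is elementary abelian, and $Q$ is the Hall $p'$-subgroup of $G$ and is abelian. Moreover, $\mathcal{CD}(G)\cong\mathcal{CD}(P)$ as lattices.
   Context: For a finite group $G$ and a subgroup $H\le G$, the Chermak-Delgado measure of $H$ in $G$ is $m_G(H)=|H|\cdot|C_G(H)|$. Put $m^*(G)=\max\{m_G(H)\mid H\le G\}$ and $\mathcal{CD}(G)=\{H\le G\mid m_G(H)=m^*(G)\}$. The set $\mathcal{CD}(G)$ is a sublattice of the subgroup lattice of $G$ (ordered by inclusion), called the Chermak-Delgado lattice of $G$. $\mathcal{L}(X)$ denotes the subgroup lattice of a group $X$, and $E_{p^n}$ denotes the elementary abelian $p$-group of order $p^n$. *)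

theory Defs
  imports "HOL-Algebra.Coset" "HOL-Computational_Algebra.Primes"
begin

definition centralizer :: "('a, 'm) monoid_scheme \<Rightarrow> 'a set \<Rightarrow> 'a set"
  where "centralizer G H = {g \<in> carrier G. \<forall>h\<in>H. g \<otimes>\<^bsub>G\<^esub> h = h \<otimes>\<^bsub>G\<^esub> g}"

definition center :: "('a, 'm) monoid_scheme \<Rightarrow> 'a set"
  where "center G = centralizer G (carrier G)"

definition cd_measure :: "('a, 'm) monoid_scheme \<Rightarrow> 'a set \<Rightarrow> nat"
  where "cd_measure G H = card H * card (centralizer G H)"

definition max_cd_measure :: "('a, 'm) monoid_scheme \<Rightarrow> nat"
  where "max_cd_measure G = Max (cd_measure G ` {H. subgroup H G})"

definition CD :: "('a, 'm) monoid_scheme \<Rightarrow> 'a set set"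
  where "CD G = {H. subgroup H G \<and> cd_measure G H = max_cd_measure G}"

definition subgroup_lattice :: "('a, 'm) monoid_scheme \<Rightarrow> 'a set gorder"
  where "subgroup_lattice G = \<lparr>carrier = {H. subgroup H G}, eq = (=), le = (\<subseteq>)\<rparr>"

definition CD_lattice :: "('a, 'm) monoid_scheme \<Rightarrow> 'a set gorder"
  where "CD_lattice G = \<lparr>carrier = CD G, eq = (=), le = (\<subseteq>)\<rparr>"

(* join_pres and meet_pres include that both arguments are lattices. *)
definition lattice_isomorphic :: "('a, 'm) gorder_scheme \<Rightarrow> ('b, 'n) gorder_scheme \<Rightarrow> bool"
  where "lattice_isomorphic X Y \<longleftrightarrow>
    (\<exists>f. bij_betw f (carrier X) (carrier Y) \<and> join_pres X Y f \<and> meet_pres X Y f)"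

(* For prime p and finite E: E is an elementary abelian p-group; the trivial group is included. *)
definition elementary_abelian :: "nat \<Rightarrow> ('a, 'm) monoid_scheme \<Rightarrow> bool"
  where "elementary_abelian p E \<longleftrightarrow>
    comm_group E \<and> (\<forall>x\<in>carrier E. x [^]\<^bsub>E\<^esub> p = \<one>\<^bsub>E\<^esub>)"

definition sylow_subgroup :: "nat \<Rightarrow> 'a set \<Rightarrow> ('a, 'm) monoid_scheme \<Rightarrow> bool"
  where "sylow_subgroup p P G \<longleftrightarrow>
    subgroup P G \<and> (\<exists>a. card P = p ^ a) \<and> \<not> p dvd card (rcosets\<^bsub>G\<^esub> P)"

definition hall_subgroup :: "nat set \<Rightarrow> 'a set \<Rightarrow> ('a, 'm) monoid_scheme \<Rightarrow> bool"
  where "hall_subgroup \<pi> H G \<longleftrightarrow>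
    subgroup H G \<and>
    (\<forall>q. prime q \<and> q dvd card H \<longrightarrow> q \<in> \<pi>) \<and>
    (\<forall>q. prime q \<and> q dvd card (rcosets\<^bsub>G\<^esub> H) \<longrightarrow> q \<notin> \<pi>)"

definition internal_direct_product :: "('a, 'm) monoid_scheme \<Rightarrow> 'a set \<Rightarrow> 'a set \<Rightarrow> bool"
  where "internal_direct_product G A B \<longleftrightarrow>
    subgroup A G \<and> subgroup B G \<and>
    (\<lambda>(a, b). a \<otimes>\<^bsub>G\<^esub> b) \<in> iso (G\<lparr>carrier := A\<rparr> \<times>\<times> G\<lparr>carrier := B\<rparr>) G"

end

theory Submission
  imports Defs "HOL-Algebra.Multiplicative_Group" "HOL-Algebra.Sylow"
begin

text \<open>Write \<open>Z\<close> for the center of \<open>G\<close>. The isomorphism makes \<open>CD G\<close> a projective geometry with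
  bottom \<open>Z\<close> in which any two members permute. Coatoms of \<open>CD G\<close> are normal, hence by duality \<open>H
  \<mapsto> C\<^sub>G(H)\<close> so are the atoms; distinct atoms therefore commute modulo \<open>Z\<close>, and as every atom
  lies in the product of two others, \<open>G/Z\<close> is abelian. In a line \<open>A B/Z = A/Z \<times> B/Z\<close> a third
  atom \<open>C\<close> is the graph of an isomorphism \<open>\<phi> : A/Z \<rightarrow> B/Z\<close>, and \<open>C\<^sub>G(C)\<close> is the graph of some \<open>\<psi>\<close>
  on \<open>C\<^sub>G(A)\<close>. That the two graphs commute is a condition linear in \<open>(\<phi>, \<psi>)\<close>, so the graphs of
  all multiples and sums of such \<open>\<phi>\<close> are again atoms. For a prime \<open>q\<close> dividing the order of
  \<open>B/Z\<close> the map \<open>q\<phi>\<close> is not injective, hence zero, and \<open>B/Z\<close> has exponent \<open>q\<close>; adding \<open>\<phi>\<close>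
  permutes the \<open>p\<close> atoms of the line other than \<open>B\<close> freely with order \<open>q\<close>, so \<open>q = p\<close>. Thus
  \<open>G/Z\<close> is elementary abelian, the \<open>p'\<close>-part of \<open>G\<close> is central, and intersecting with the Sylow
  \<open>p\<close>-subgroup identifies the two lattices.\<close>

section \<open>The Chermak-Delgado lattice\<close>

context group
begin

text \<open>The isomorphism preserves inclusion and nothing else: orders are invisible to it, and
  nothing tells in advance how large an atom is modulo Z. So p can enter only as a number of atoms,
  namely those on a line AB apart from B, and a group acting on these atoms has to be found; adding
  multiples of phi is such an action. The obstacle is to see that a shifted atom S is still in
  CD(G). Membership is a lower bound for |S| |C_G(S)|; the order of S is clear, but its centralizer
  has to be exhibited. This is why every construction is made on two lines, that of A, B, C and that
  of their centralizers, as instances of one locale with N = Z and N = C_G(AB). The map phi is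
  handled as a relation between representatives in G, not as a map of quotient groups, because
  commutators are computed in G, where class two makes them bilinear.\<close>

lemma inv_cancel_left [simp]:
  assumes "x \<in> carrier G" "y \<in> carrier G"
  shows "inv x \<otimes> (x \<otimes> y) = y" "x \<otimes> (inv x \<otimes> y) = y"
  using assms by (simp_all add: m_assoc [symmetric])

lemma mem_set_mult: "x \<in> H <#> K \<longleftrightarrow> (\<exists>h\<in>H. \<exists>k\<in>K. x = h \<otimes> k)"
  by (auto simp: set_mult_def)

lemma subset_set_mult:
  assumes "subgroup H G" "subgroup K G"
  shows "H \<subseteq> H <#> K" "K \<subseteq> H <#> K"
proof -
  show "H \<subseteq> H <#> K"
    unfolding set_mult_def using assms
    by (force dest: subgroup.one_closed subgroup.mem_carrier intro: bexI [of _ \<one>])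
  show "K \<subseteq> H <#> K"
    unfolding set_mult_def using assms
    by (force dest: subgroup.one_closed subgroup.mem_carrier intro: bexI [of _ \<one>])
qed

lemma set_mult_least:
  "subgroup M G \<Longrightarrow> H \<subseteq> M \<Longrightarrow> K \<subseteq> M \<Longrightarrow> H <#> K \<subseteq> M"
  by (auto simp: mem_set_mult subset_iff subgroup.m_closed)

text \<open>A product determines its factorization up to \<open>H \<inter> K\<close>: from one
  chosen pair \<open>(h y, k y)\<close> all others arise by inserting an element t of the
  intersection and its inverse between the two factors.\<close>

lemma card_set_mult_Int:
  assumes H: "subgroup H G" and K: "subgroup K G"
  shows "card (H <#> K) * card (H \<inter> K) = card H * card K"
proof -
  have "\<forall>y. \<exists>h k. y \<in> H <#> K \<longrightarrow> h \<in> H \<and> k \<in> K \<and> y = h \<otimes> k"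
    by (auto simp: mem_set_mult)
  then obtain h k where hk: "\<And>y. y \<in> H <#> K \<Longrightarrow> h y \<in> H \<and> k y \<in> K \<and> y = h y \<otimes> k y"
    by metis
  note [simp] = subgroup.mem_carrier [OF H] subgroup.mem_carrier [OF K]
    subgroup.m_inv_closed [OF H] subgroup.m_inv_closed [OF K]
    subgroup.m_closed [OF H] subgroup.m_closed [OF K]
  have "bij_betw (\<lambda>(y, t). (h y \<otimes> t, inv t \<otimes> k y)) ((H <#> K) \<times> (H \<inter> K)) (H \<times> K)"
    unfolding bij_betw_def
  proof
    have eq: "y = (h y \<otimes> t) \<otimes> (inv t \<otimes> k y)" if "y \<in> H <#> K" "t \<in> H \<inter> K" for y t
      using that hk [of y] by (simp add: m_assoc)
    show "inj_on (\<lambda>(y, t). (h y \<otimes> t, inv t \<otimes> k y)) ((H <#> K) \<times> (H \<inter> K))"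
    proof (rule inj_onI, clarsimp)
      fix y t y' t'
      assume *: "y \<in> H <#> K" "t \<in> H" "t \<in> K" "y' \<in> H <#> K" "t' \<in> H" "t' \<in> K"
        "h y \<otimes> t = h y' \<otimes> t'" "inv t \<otimes> k y = inv t' \<otimes> k y'"
      then have "y = y'"
        using eq [of y t] eq [of y' t'] by simp
      with * show "y = y' \<and> t = t'"
        using hk [of y'] by (metis H K Units_eq Units_l_cancel subgroup.mem_carrier)
    qed
    show "(\<lambda>(y, t). (h y \<otimes> t, inv t \<otimes> k y)) ` ((H <#> K) \<times> (H \<inter> K)) = H \<times> K"
    proof (intro subset_antisym subsetI)
      fix w assume "w \<in> H \<times> K"
      then obtain a b where w: "w = (a, b)" and ab: "a \<in> H" "b \<in> K" by blast
      define y where "y = a \<otimes> b"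
      have y: "y \<in> H <#> K" using ab by (auto simp: y_def mem_set_mult)
      obtain c d where cd: "h y = c" "k y = d" "c \<in> H" "d \<in> K" using hk [OF y] by blast
      have e: "c \<otimes> d = a \<otimes> b" using hk [OF y] cd y_def by simp
      define t where "t = inv c \<otimes> a"
      have "a = c \<otimes> d \<otimes> inv b" using ab cd unfolding e by (simp add: m_assoc)
      then have "t = d \<otimes> inv b"
        using ab cd by (simp add: t_def m_assoc)
      then have "t \<in> K" using ab cd by simp
      moreover have "t \<in> H" using ab cd by (simp add: t_def)
      ultimately have t: "t \<in> H \<inter> K" by simp
      have "h y \<otimes> t = a" using cd ab by (simp add: t_def)
      moreover have "inv t \<otimes> k y = b"
        using cd ab e by (simp add: t_def inv_mult_group m_assoc)
      ultimately have "h y \<otimes> t = a" "inv t \<otimes> k y = b" by auto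
      with y t w show "w \<in> (\<lambda>(y, t). (h y \<otimes> t, inv t \<otimes> k y)) ` ((H <#> K) \<times> (H \<inter> K))"
        by force
    qed (use hk in auto)
  qed
  then show ?thesis
    using bij_betw_same_card by (fastforce simp: card_cartesian_product)
qed

text \<open>Left translation by an element x of a finite closed set is injective and hence permutes
  the set; solving x = x e and 1 = x y inside it yields the unit and the inverse.\<close>

lemma subgroup_if_finite_closed:
  assumes "finite H" "H \<subseteq> carrier G" "H \<noteq> {}" "\<And>x y. x \<in> H \<Longrightarrow> y \<in> H \<Longrightarrow> x \<otimes> y \<in> H"
  shows "subgroup H G"
proof (rule subgroupI)
  fix x assume x: "x \<in> H"
  then have xG: "x \<in> carrier G" using assms(2) by blast
  have "inj_on (\<lambda>y. x \<otimes> y) H"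
    using assms(2) xG by (intro inj_onI) (metis Units_eq Units_l_cancel subsetD)
  moreover have "(\<lambda>y. x \<otimes> y) ` H \<subseteq> H" using assms(4) x by blast
  ultimately have surj: "(\<lambda>y. x \<otimes> y) ` H = H"
    using assms(1) by (intro endo_inj_surj)
  then obtain e where e: "e \<in> H" "x = x \<otimes> e" using x by blast
  moreover have eG: "e \<in> carrier G" using e assms(2) by blast
  ultimately have "e = \<one>" using xG by simp
  then obtain y where y: "y \<in> H" "\<one> = x \<otimes> y" using surj e(1) by blast
  moreover have yG: "y \<in> carrier G" using y assms(2) by blast
  ultimately have "inv y = x" using xG by (intro inv_equality) simp_all
  then have "inv x = y" using yG by auto
  then show "inv x \<in> H" using y by simp
qed (use assms in auto)

lemma pow_closed_subgroup: "subgroup H G \<Longrightarrow> x \<in> H \<Longrightarrow> x [^] (k::nat) \<in> H"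
  by (induction k) (auto simp: subgroup.one_closed subgroup.m_closed)

lemma centralizer_subgroup:
  assumes "H \<subseteq> carrier G" shows "subgroup (centralizer G H) G"
proof (rule subgroupI)
  fix x assume x: "x \<in> centralizer G H"
  then have xG: "x \<in> carrier G" by (simp add: centralizer_def)
  { fix h assume h: "h \<in> H"
    then have hG: "h \<in> carrier G" using assms by blast
    have e: "x \<otimes> h = h \<otimes> x" using x h by (simp add: centralizer_def)
    have "inv x \<otimes> h = inv x \<otimes> (h \<otimes> x) \<otimes> inv x" using xG hG by (simp add: m_assoc)
    also have "\<dots> = h \<otimes> inv x" unfolding e [symmetric] using xG hG by (simp add: m_assoc)
    finally have "inv x \<otimes> h = h \<otimes> inv x" . }
  then show "inv x \<in> centralizer G H" using xG by (simp add: centralizer_def)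
next
  fix x y assume x: "x \<in> centralizer G H" and y: "y \<in> centralizer G H"
  then have xG: "x \<in> carrier G" "y \<in> carrier G" by (simp_all add: centralizer_def)
  { fix h assume h: "h \<in> H"
    then have hG: "h \<in> carrier G" using assms by blast
    have "x \<otimes> y \<otimes> h = x \<otimes> (h \<otimes> y)" using xG hG y h by (simp add: m_assoc centralizer_def)
    also have "\<dots> = h \<otimes> (x \<otimes> y)"
      using xG hG x h by (simp add: m_assoc [symmetric] centralizer_def)
    finally have "x \<otimes> y \<otimes> h = h \<otimes> (x \<otimes> y)" . }
  then show "x \<otimes> y \<in> centralizer G H" using xG by (simp add: centralizer_def)
qed (use assms in \<open>auto simp: centralizer_def intro!: exI [of _ \<one>]\<close>)

lemma centralizer_anti: "H \<subseteq> K \<Longrightarrow> centralizer G K \<subseteq> centralizer G H"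
  by (auto simp: centralizer_def)

lemma subset_centralizer_centralizer:
  "H \<subseteq> carrier G \<Longrightarrow> H \<subseteq> centralizer G (centralizer G H)"
  by (auto simp: centralizer_def subset_iff)

lemma center_subgroup: "subgroup (center G) G"
  by (simp add: center_def centralizer_subgroup)

lemma center_commutes: "z \<in> center G \<Longrightarrow> x \<in> carrier G \<Longrightarrow> z \<otimes> x = x \<otimes> z"
  by (simp add: center_def centralizer_def)

lemma center_carrier: "z \<in> center G \<Longrightarrow> z \<in> carrier G"
  by (simp add: center_def centralizer_def)

lemma center_subset_centralizer: "H \<subseteq> carrier G \<Longrightarrow> center G \<subseteq> centralizer G H"
  unfolding center_def by (rule centralizer_anti)

text \<open>The elements commuting with a fixed x form a subgroup, so commuting with all of
  \<open>H\<close> and all of \<open>K\<close> passes to their products.\<close>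

lemma centralizer_set_mult:
  assumes H: "subgroup H G" and K: "subgroup K G"
  shows "centralizer G (H <#> K) = centralizer G H \<inter> centralizer G K"
proof
  show "centralizer G (H <#> K) \<subseteq> centralizer G H \<inter> centralizer G K"
    using subset_set_mult [OF H K] by (simp add: centralizer_anti)
  show "centralizer G H \<inter> centralizer G K \<subseteq> centralizer G (H <#> K)"
  proof
    fix x assume x: "x \<in> centralizer G H \<inter> centralizer G K"
    then have "subgroup (centralizer G {x}) G"
      by (intro centralizer_subgroup) (auto simp: centralizer_def)
    moreover have "H \<subseteq> centralizer G {x}" "K \<subseteq> centralizer G {x}"
      using x H K by (auto simp: centralizer_def dest: subgroup.mem_carrier)
    ultimately have "H <#> K \<subseteq> centralizer G {x}" by (rule set_mult_least)
    then show "x \<in> centralizer G (H <#> K)"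
      using x by (auto simp: centralizer_def subset_iff)
  qed
qed

end

locale finite_group = group +
  assumes fin [simp]: "finite (carrier G)"
begin

lemma finite_subgroup [simp]: "subgroup H G \<Longrightarrow> finite H"
  by (meson fin finite_subset subgroup.subset)

lemma card_subgroup_pos: "subgroup H G \<Longrightarrow> card H > 0"
  by (metis card_gt_0_iff empty_iff finite_subgroup subgroup.one_closed)

lemma finite_subgroups: "finite {H. subgroup H G}"
  by (rule finite_subset [of _ "Pow (carrier G)"]) (auto dest: subgroup.mem_carrier)

lemma cd_measure_le: "subgroup H G \<Longrightarrow> cd_measure G H \<le> max_cd_measure G"
  unfolding max_cd_measure_def by (intro Max_ge) (auto simp: finite_subgroups)

lemma CD_subgroup: "H \<in> CD G \<Longrightarrow> subgroup H G"
  by (simp add: CD_def)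

lemma CD_subset: "H \<in> CD G \<Longrightarrow> H \<subseteq> carrier G"
  by (simp add: CD_def subgroup.subset)

lemma CD_centralizer_subgroup: "H \<in> CD G \<Longrightarrow> subgroup (centralizer G H) G"
  by (simp add: CD_subset centralizer_subgroup)

lemma CD_card: "H \<in> CD G \<Longrightarrow> card H * card (centralizer G H) = max_cd_measure G"
  by (simp add: CD_def cd_measure_def)

text \<open>Maximality makes one inequality enough: conjugates and shifted atoms are placed in
  \<open>CD G\<close> by bounding their centralizers from below.\<close>

lemma CD_I:
  "subgroup H G \<Longrightarrow> max_cd_measure G \<le> card H * card (centralizer G H) \<Longrightarrow> H \<in> CD G"
  using cd_measure_le [of H] by (simp add: CD_def cd_measure_def)

lemma CD_nonempty: "CD G \<noteq> {}"
proof -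
  have "max_cd_measure G \<in> cd_measure G ` {H. subgroup H G}"
    unfolding max_cd_measure_def
    by (rule Max_in) (use finite_subgroups subgroup_self in auto)
  then show ?thesis by (auto simp: CD_def)
qed

text \<open>As \<open>H\<close> lies in its double centralizer, passing to the centralizer cannot
  lower the measure; since the measure is maximal already, the double centralizer cannot be larger
  than \<open>H\<close>.\<close>

lemma CD_centralizer:
  assumes H: "H \<in> CD G"
  shows "centralizer G H \<in> CD G" "centralizer G (centralizer G H) = H"
proof -
  note sC = CD_centralizer_subgroup [OF H]
  have sub: "H \<subseteq> centralizer G (centralizer G H)"
    using CD_subset [OF H] by (rule subset_centralizer_centralizer)
  have sCC: "subgroup (centralizer G (centralizer G H)) G"
    using sC by (simp add: centralizer_subgroup subgroup.subset)
  have le: "card H \<le> card (centralizer G (centralizer G H))"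
    using sub sCC by (simp add: card_mono)
  then show C: "centralizer G H \<in> CD G"
    using sC CD_card [OF H] by (intro CD_I) (simp_all add: mult.commute [of "card H"] flip: CD_card [OF H])
  have "card (centralizer G (centralizer G H)) = card H"
    using CD_card [OF H] CD_card [OF C] card_subgroup_pos [OF sC]
    by (simp add: mult.commute [of "card H"] flip: CD_card [OF H])
  then show "centralizer G (centralizer G H) = H"
    using sub sCC by (metis card_subset_eq finite_subgroup)
qed

lemma center_subset_CD:
  assumes "H \<in> CD G" shows "center G \<subseteq> H"
  using CD_centralizer [OF assms] center_subset_centralizer CD_subset by metis

text \<open>The inequality \<open>m(H) m(K) \<le> m(H \<inter> K) m(\<langle>H, K\<rangle>)\<close> is an equality here, which forces
  \<open>\<langle>H, K\<rangle> = HK\<close>.\<close>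

lemma CD_Int_set_mult:
  assumes H: "H \<in> CD G" and K: "K \<in> CD G"
  shows "H \<inter> K \<in> CD G" "H <#> K \<in> CD G"
    "centralizer G (H \<inter> K) = centralizer G H <#> centralizer G K"
proof -
  note sH = CD_subgroup [OF H] and sK = CD_subgroup [OF K]
  define J where "J = generate G (H \<union> K)"
  have HK: "H \<union> K \<subseteq> carrier G" using H K by (simp add: CD_subset)
  have sJ: "subgroup J G" unfolding J_def using HK by (rule generate_is_subgroup)
  have HJ: "H \<subseteq> J" "K \<subseteq> J" unfolding J_def by (auto intro: generate.incl)
  have HKJ: "H <#> K \<subseteq> J" using sJ HJ by (rule set_mult_least)
  have sI: "subgroup (H \<inter> K) G" using sH sK by (rule subgroups_Inter_pair)
  note sCH = CD_centralizer_subgroup [OF H] and sCK = CD_centralizer_subgroup [OF K]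
  define cJ where "cJ = centralizer G H \<inter> centralizer G K"
  have CJ: "centralizer G J = cJ"
  proof
    show "centralizer G J \<subseteq> cJ" using HJ by (simp add: cJ_def centralizer_anti)
    show "cJ \<subseteq> centralizer G J"
    proof
      fix x assume x: "x \<in> cJ"
      then have "subgroup (centralizer G {x}) G"
        by (intro centralizer_subgroup) (auto simp: cJ_def centralizer_def)
      moreover have "H \<union> K \<subseteq> centralizer G {x}"
        using x HK by (auto simp: cJ_def centralizer_def)
      ultimately have "J \<subseteq> centralizer G {x}"
        unfolding J_def by (metis generate_subgroup_incl)
      then show "x \<in> centralizer G J"
        using x by (auto simp: cJ_def centralizer_def subset_iff)
    qed
  qed
  have sCI: "subgroup (centralizer G (H \<inter> K)) G"
    using sI by (simp add: centralizer_subgroup subgroup.subset)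
  have CI: "centralizer G H <#> centralizer G K \<subseteq> centralizer G (H \<inter> K)"
    using sCI by (rule set_mult_least) (auto simp: centralizer_def)
  define M where "M = max_cd_measure G"
  define a b c d where "a = card (H \<inter> K)" and "b = card J"
    and "c = card (centralizer G (H \<inter> K))" and "d = card cJ"
  define b' c' where "b' = card (H <#> K)" and "c' = card (centralizer G H <#> centralizer G K)"
  have pos: "a > 0" "b > 0" "c > 0" "d > 0"
    using sI sJ sCI CJ by (auto simp: a_def b_def c_def d_def cJ_def sCH sCK subgroups_Inter_pair
        intro!: card_subgroup_pos)
  have le: "b' \<le> b" "c' \<le> c"
    using HKJ CI sJ sCI by (auto simp: b_def b'_def c_def c'_def intro!: card_mono)
  have e1: "b' * a = card H * card K"
    using card_set_mult_Int [OF sH sK] by (simp add: a_def b'_def)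
  have e2: "c' * d = card (centralizer G H) * card (centralizer G K)"
    using card_set_mult_Int [OF sCH sCK] by (simp add: c'_def d_def cJ_def)
  have MM: "M * M = (b' * a) * (c' * d)"
    unfolding e1 e2 using CD_card [OF H] CD_card [OF K] by (simp add: M_def algebra_simps)
  have m1: "a * c \<le> M" using cd_measure_le [OF sI] by (simp add: cd_measure_def a_def c_def M_def)
  have m2: "b * d \<le> M"
    using cd_measure_le [OF sJ] CJ by (simp add: cd_measure_def b_def d_def M_def)
  \<comment> \<open>The following chain starts and ends at \<open>M * M\<close>, so each of its
    links is an equality. In particular \<open>b' = b\<close> makes the product all of
    \<open>J\<close>, and \<open>c' = c\<close> gives the claim on the centralizer of the
    intersection.\<close>
  have "M * M \<le> (a * c') * (b' * d)" using MM by (simp add: algebra_simps)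
  moreover have "(a * c') * (b' * d) \<le> (a * c) * (b' * d)" using le by simp
  moreover have "(a * c) * (b' * d) \<le> (a * c) * (b * d)" using le by simp
  moreover have "(a * c) * (b * d) \<le> M * (b * d)" using m1 by (metis mult_le_mono1)
  moreover have "M * (b * d) \<le> M * M" using m2 by (metis mult_le_mono2)
  moreover have "M > 0" using pos m1 by (metis gr0I le_zero_eq mult_is_0 less_not_refl)
  ultimately have eqs: "M * (b * d) = M * M" "(a * c) * (b * d) = M * (b * d)"
    "(a * c) * (b' * d) = (a * c) * (b * d)" "(a * c') * (b' * d) = (a * c) * (b' * d)"
    by linarith+
  have "b * d = M" using eqs(1) \<open>M > 0\<close> by simp
  moreover have "a * c = M" using eqs(2) pos by simp
  moreover have "b' = b" using eqs(3) pos by simp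
  moreover have "c' = c" using eqs(4) pos \<open>b' = b\<close> by simp
  ultimately have *: "b * d = M" "a * c = M" "b' = b" "c' = c" by auto
  show "H \<inter> K \<in> CD G" using * sI by (simp add: CD_def cd_measure_def a_def c_def M_def)
  have "H <#> K = J"
    using * HKJ sJ by (simp add: b_def b'_def card_subset_eq)
  moreover have "J \<in> CD G" using * sJ CJ by (simp add: CD_def cd_measure_def b_def d_def M_def)
  ultimately show "H <#> K \<in> CD G" by simp
  show "centralizer G (H \<inter> K) = centralizer G H <#> centralizer G K"
    using * CI sCI by (metis c_def c'_def card_subset_eq finite_subgroup)
qed

end

section \<open>Commutators in groups of class two\<close>

context group
begin

definition commutator :: "'a \<Rightarrow> 'a \<Rightarrow> 'a"
  where "commutator x y = (x \<otimes> y) \<otimes> inv (y \<otimes> x)"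

lemma commutator_closed [simp]:
  "x \<in> carrier G \<Longrightarrow> y \<in> carrier G \<Longrightarrow> commutator x y \<in> carrier G"
  by (simp add: commutator_def)

lemma commutator_swap:
  "x \<in> carrier G \<Longrightarrow> y \<in> carrier G \<Longrightarrow> x \<otimes> y = commutator x y \<otimes> (y \<otimes> x)"
  by (simp add: commutator_def m_assoc)

lemma commutator_eq_one_iff:
  assumes "x \<in> carrier G" "y \<in> carrier G"
  shows "commutator x y = \<one> \<longleftrightarrow> x \<otimes> y = y \<otimes> x"
proof
  assume "commutator x y = \<one>" then show "x \<otimes> y = y \<otimes> x"
    using commutator_swap [OF assms] assms by simp
qed (use assms in \<open>simp add: commutator_def\<close>)

lemma commutator_unique:
  assumes "x \<in> carrier G" "y \<in> carrier G" "c \<in> carrier G" "x \<otimes> y = c \<otimes> (y \<otimes> x)"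
  shows "commutator x y = c"
  using assms by (simp add: commutator_def m_assoc inv_mult_group)

lemma commutator_inverse:
  assumes "x \<in> carrier G" "y \<in> carrier G"
  shows "commutator y x = inv (commutator x y)"
  using assms by (simp add: commutator_def inv_mult_group)

text \<open>Only the commutator of \<open>y\<close> and \<open>w\<close> has to be central, so the
  rule is available before \<open>G\<close> is known to have class two;
  \<open>centralizer_mod_subgroup\<close> uses it at that stage.\<close>

lemma commutator_mult_central:
  assumes xyw: "x \<in> carrier G" "y \<in> carrier G" "w \<in> carrier G"
    and z: "commutator y w \<in> center G"
  shows "commutator (x \<otimes> y) w = commutator x w \<otimes> commutator y w"
proof (rule commutator_unique)
  define c where "c = commutator y w"
  define d where "d = commutator x w"
  have cd [simp]: "c \<in> carrier G" "d \<in> carrier G" using xyw by (simp_all add: c_def d_def)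
  have "x \<otimes> y \<otimes> w = x \<otimes> (c \<otimes> (w \<otimes> y))"
    using commutator_swap [OF xyw(2,3)] xyw by (simp add: m_assoc c_def)
  also have "\<dots> = c \<otimes> (x \<otimes> w) \<otimes> y"
    using xyw z center_commutes [of c x] by (simp add: c_def flip: m_assoc)
  also have "\<dots> = c \<otimes> (d \<otimes> (w \<otimes> x)) \<otimes> y"
    using commutator_swap [OF xyw(1,3)] by (simp add: d_def)
  also have "\<dots> = d \<otimes> c \<otimes> (w \<otimes> (x \<otimes> y))"
    using xyw z center_commutes [of c d] cd unfolding c_def [symmetric]
    by (simp add: m_assoc [symmetric])
  finally show "x \<otimes> y \<otimes> w = commutator x w \<otimes> commutator y w \<otimes> (w \<otimes> (x \<otimes> y))"
    by (simp add: c_def d_def)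
qed (use xyw in auto)

end

locale class2_group = finite_group +
  assumes commutator_center: "x \<in> carrier G \<Longrightarrow> y \<in> carrier G \<Longrightarrow> commutator x y \<in> center G"
begin

lemma commutator_mult_left:
  "x \<in> carrier G \<Longrightarrow> y \<in> carrier G \<Longrightarrow> w \<in> carrier G \<Longrightarrow>
    commutator (x \<otimes> y) w = commutator x w \<otimes> commutator y w"
  by (simp add: commutator_mult_central commutator_center)

lemma commutator_mult_right:
  assumes "x \<in> carrier G" "y \<in> carrier G" "w \<in> carrier G"
  shows "commutator w (x \<otimes> y) = commutator w x \<otimes> commutator w y"
proof -
  have "commutator w (x \<otimes> y) = inv (commutator x w \<otimes> commutator y w)"
    using assms by (simp add: commutator_inverse [of "x \<otimes> y" w] commutator_mult_left)
  also have "\<dots> = commutator w y \<otimes> commutator w x"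
    using assms by (simp add: inv_mult_group commutator_inverse [of x w] commutator_inverse [of y w])
  also have "\<dots> = commutator w x \<otimes> commutator w y"
    using assms by (simp add: center_commutes commutator_center)
  finally show ?thesis .
qed

lemma commutator_pow_left:
  assumes "x \<in> carrier G" "y \<in> carrier G"
  shows "commutator (x [^] (k::nat)) y = commutator x y [^] k"
  using assms by (induction k) (simp_all add: commutator_mult_left commutator_eq_one_iff)

lemma commutator_pow_right:
  assumes "x \<in> carrier G" "y \<in> carrier G"
  shows "commutator y (x [^] (k::nat)) = commutator y x [^] k"
  using assms by (induction k) (simp_all add: commutator_mult_right commutator_eq_one_iff)

text \<open>Moving x past a power of y costs one central commutator, and these accumulate in z:
  modulo the center the power map is a homomorphism.\<close>

lemma pow_mult_center:
  assumes x: "x \<in> carrier G" and y: "y \<in> carrier G"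
  shows "\<exists>z\<in>center G. (x \<otimes> y) [^] (k::nat) = z \<otimes> (x [^] k \<otimes> y [^] k)"
proof (induction k)
  case 0
  then show ?case
    using subgroup.one_closed [OF center_subgroup] by (intro bexI [of _ \<one>]) simp_all
next
  case (Suc k)
  then obtain z where z: "z \<in> center G" "(x \<otimes> y) [^] k = z \<otimes> (x [^] k \<otimes> y [^] k)" by blast
  define c where "c = commutator (y [^] k) x"
  have c: "c \<in> center G" unfolding c_def using x y by (simp add: commutator_center)
  have cG: "c \<in> carrier G" "z \<in> carrier G" using c z by (simp_all add: center_carrier)
  have "(x \<otimes> y) [^] Suc k = z \<otimes> (x [^] k \<otimes> (y [^] k \<otimes> x) \<otimes> y)"
    using z x y cG by (simp add: m_assoc)
  also have "\<dots> = z \<otimes> (x [^] k \<otimes> (c \<otimes> (x \<otimes> y [^] k)) \<otimes> y)"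
    using commutator_swap [of "y [^] k" x] x y by (simp add: c_def)
  also have "\<dots> = z \<otimes> (x [^] k \<otimes> c \<otimes> (x \<otimes> y [^] k) \<otimes> y)"
    using x y cG by (simp add: m_assoc)
  also have "\<dots> = z \<otimes> (c \<otimes> x [^] k \<otimes> (x \<otimes> y [^] k) \<otimes> y)"
    using center_commutes [OF c, of "x [^] k"] x by simp
  also have "\<dots> = (z \<otimes> c) \<otimes> (x [^] Suc k \<otimes> y [^] Suc k)"
    using x y cG by (simp add: m_assoc)
  finally show ?case using subgroup.m_closed [OF center_subgroup z(1) c] by blast
qed

lemma pow_mult_modulo:
  assumes "x \<in> carrier G" "y \<in> carrier G"
  shows "\<exists>z\<in>center G. x [^] (k::nat) \<otimes> y [^] k = z \<otimes> (x \<otimes> y) [^] k"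
proof -
  obtain z where z: "z \<in> center G" "(x \<otimes> y) [^] k = z \<otimes> (x [^] k \<otimes> y [^] k)"
    using pow_mult_center assms by blast
  then have "inv z \<in> center G"
    by (simp add: subgroup.m_inv_closed [OF center_subgroup])
  moreover have "x [^] k \<otimes> y [^] k = inv z \<otimes> (x \<otimes> y) [^] k"
    using z assms by (simp add: center_carrier)
  ultimately show ?thesis by blast
qed

lemma swap_mem:
  assumes H: "subgroup H G" "center G \<subseteq> H" and xy: "x \<in> carrier G" "y \<in> carrier G"
    and "x \<otimes> y \<in> H"
  shows "y \<otimes> x \<in> H"
proof -
  have "y \<otimes> x = commutator y x \<otimes> (x \<otimes> y)" by (rule commutator_swap [OF xy(2,1)])
  then show ?thesis using assms commutator_center [OF xy(2,1)] by (auto intro: subgroup.m_closed)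
qed

end

section \<open>Translations of a line\<close>

text \<open>\<open>A\<close> and \<open>C\<close> are two complements of B/N in AB/N. Quotients by
  \<open>N\<close> make sense because a subgroup containing the center is normal when all
  commutators are central. \<open>N\<close> is a parameter since the line of the centralizers has a
  larger bottom than the center.\<close>

locale line = class2_group +
  fixes A B C N
  assumes sA: "subgroup A G" and sB: "subgroup B G" and sC: "subgroup C G"
    and ZN: "center G \<subseteq> N" and AB: "A \<inter> B = N" and CB: "C \<inter> B = N"
    and span: "A <#> B = C <#> B"
begin

lemma sN: "subgroup N G"
  using subgroups_Inter_pair [OF sA sB] AB by simp

lemma N_sub: "N \<subseteq> A" "N \<subseteq> B" "N \<subseteq> C"
  using AB CB by auto

lemma Z_sub: "center G \<subseteq> A" "center G \<subseteq> B" "center G \<subseteq> C"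
  using N_sub ZN by auto

lemmas line_carrier [simp] = subgroup.mem_carrier [OF sA] subgroup.mem_carrier [OF sB]
  subgroup.mem_carrier [OF sC] subgroup.mem_carrier [OF sN]

text \<open>\<open>tr x b\<close> says that \<open>b\<close> represents \<open>\<phi>(x)\<close>, where \<open>\<phi> : AB \<rightarrow> B/N\<close> is the homomorphism that vanishes
  on \<open>B\<close> and whose graph over \<open>A\<close> is \<open>C\<close>.\<close>

definition tr :: "'a \<Rightarrow> 'a \<Rightarrow> bool"
  where "tr x b \<longleftrightarrow> x \<in> carrier G \<and> b \<in> B \<and> (\<exists>a\<in>A. a \<otimes> b \<in> C \<and> inv a \<otimes> x \<in> B)"

lemma tr_closed: "tr x b \<Longrightarrow> x \<in> carrier G" "tr x b \<Longrightarrow> b \<in> B" "tr x b \<Longrightarrow> b \<in> carrier G"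
  by (auto simp: tr_def)

text \<open>Sorting the factors in \<open>C\<close> and in \<open>B\<close> produces only
  commutators; these are central and hence lie in both subgroups.\<close>

lemma tr_mult:
  assumes 1: "tr x b" and 2: "tr y c"
  shows "tr (x \<otimes> y) (b \<otimes> c)"
proof -
  obtain a where a: "a \<in> A" "a \<otimes> b \<in> C" "inv a \<otimes> x \<in> B" using 1 by (auto simp: tr_def)
  obtain a' where a': "a' \<in> A" "a' \<otimes> c \<in> C" "inv a' \<otimes> y \<in> B" using 2 by (auto simp: tr_def)
  note [simp] = tr_closed(1,3) [OF 1] tr_closed(1,3) [OF 2] line_carrier(1) [OF a(1)]
    line_carrier(1) [OF a'(1)]
  have "(a \<otimes> a') \<otimes> (b \<otimes> c) = a \<otimes> (a' \<otimes> b) \<otimes> c" by (simp add: m_assoc)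
  also have "\<dots> = a \<otimes> (commutator a' b \<otimes> (b \<otimes> a')) \<otimes> c" by (simp flip: commutator_swap)
  also have "\<dots> = (a \<otimes> commutator a' b) \<otimes> (b \<otimes> a') \<otimes> c" by (simp add: m_assoc)
  also have "\<dots> = (commutator a' b \<otimes> a) \<otimes> (b \<otimes> a') \<otimes> c"
    using center_commutes [of "commutator a' b" a] commutator_center by simp
  also have "\<dots> = commutator a' b \<otimes> ((a \<otimes> b) \<otimes> (a' \<otimes> c))" by (simp add: m_assoc)
  finally have 3: "(a \<otimes> a') \<otimes> (b \<otimes> c) \<in> C"
    using subgroup.m_closed [OF sC] a a' Z_sub commutator_center by (simp add: subset_iff)
  have "inv (a \<otimes> a') \<otimes> (x \<otimes> y) = (inv a' \<otimes> (inv a \<otimes> x)) \<otimes> y"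
    by (simp add: inv_mult_group m_assoc)
  also have "\<dots> = commutator (inv a') (inv a \<otimes> x) \<otimes> ((inv a \<otimes> x) \<otimes> (inv a')) \<otimes> y"
    by (subst commutator_swap) simp_all
  also have "\<dots> = commutator (inv a') (inv a \<otimes> x) \<otimes> ((inv a \<otimes> x) \<otimes> (inv a' \<otimes> y))"
    by (simp add: m_assoc)
  finally have 4: "inv (a \<otimes> a') \<otimes> (x \<otimes> y) \<in> B"
    using subgroup.m_closed [OF sB] a a' Z_sub commutator_center by (simp add: subset_iff)
  show ?thesis
    unfolding tr_def using 3 4 a(1) a'(1) tr_closed(2) [OF 1] tr_closed(2) [OF 2]
    by (auto intro: subgroup.m_closed [OF sB] subgroup.m_closed [OF sA])
qed

lemma tr_N: "x \<in> B \<Longrightarrow> n \<in> N \<Longrightarrow> tr x n"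
  unfolding tr_def using N_sub subgroup.one_closed [OF sA] by (auto intro!: bexI [of _ \<one>])

text \<open>This makes phi well defined. Two choices of the component in \<open>A\<close> differ by
  an element m of \<open>A \<inter> B = N\<close>; comparing the corresponding elements of
  \<open>C\<close> leaves b^-1 m c in \<open>C \<inter> B = N\<close>, and normality of
  \<open>N\<close> removes m.\<close>

lemma tr_unique:
  assumes 1: "tr x b" and 2: "tr x c"
  shows "inv b \<otimes> c \<in> N"
proof -
  obtain a where a: "a \<in> A" "a \<otimes> b \<in> C" "inv a \<otimes> x \<in> B" using 1 by (auto simp: tr_def)
  obtain a' where a': "a' \<in> A" "a' \<otimes> c \<in> C" "inv a' \<otimes> x \<in> B" using 2 by (auto simp: tr_def)
  note [simp] = tr_closed(1,3) [OF 1] tr_closed(1,3) [OF 2] line_carrier(1) [OF a(1)]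
    line_carrier(1) [OF a'(1)]
  define m where "m = inv a \<otimes> a'"
  have "m = (inv a \<otimes> x) \<otimes> inv (inv a' \<otimes> x)" by (simp add: m_def inv_mult_group m_assoc)
  then have "m \<in> B" using a a' sB by (simp add: subgroup.m_closed subgroup.m_inv_closed)
  moreover have "m \<in> A" using a a' sA by (simp add: m_def subgroup.m_closed subgroup.m_inv_closed)
  ultimately have m: "m \<in> N" using AB by blast
  then have [simp]: "m \<in> carrier G" by simp
  have "inv (a \<otimes> b) \<otimes> (a' \<otimes> c) = inv b \<otimes> (m \<otimes> c)"
    by (simp add: m_def inv_mult_group m_assoc)
  moreover have "inv (a \<otimes> b) \<otimes> (a' \<otimes> c) \<in> C"
    using a a' sC by (simp add: subgroup.m_closed subgroup.m_inv_closed)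
  moreover have "inv b \<otimes> (m \<otimes> c) \<in> B"
    using tr_closed(2) [OF 1] tr_closed(2) [OF 2] m N_sub sB
    by (simp add: subgroup.m_closed subgroup.m_inv_closed subset_iff)
  ultimately have "inv b \<otimes> (m \<otimes> c) \<in> N" using CB by auto
  then have "(m \<otimes> c) \<otimes> inv b \<in> N" using swap_mem [OF sN ZN, of "inv b" "m \<otimes> c"] by simp
  then have "inv m \<otimes> ((m \<otimes> c) \<otimes> inv b) \<in> N"
    using m sN by (simp add: subgroup.m_closed subgroup.m_inv_closed)
  then have "c \<otimes> inv b \<in> N" by (simp add: m_assoc)
  then show ?thesis using swap_mem [OF sN ZN, of c "inv b"] by simp
qed

lemma tr_B: "tr x b \<Longrightarrow> x \<in> B \<Longrightarrow> b \<in> N"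
  using tr_unique [of x \<one> b] tr_N [of x \<one>] subgroup.one_closed [OF sN]
  by (simp add: tr_closed)

lemma tr_mult_N: "tr x b \<Longrightarrow> n \<in> N \<Longrightarrow> tr (n \<otimes> x) b"
  using tr_mult [OF tr_N [of n \<one>], of x b] subgroup.one_closed [OF sN] N_sub(2)
  by (simp add: tr_closed subset_iff)

text \<open>If the component a in \<open>A\<close> is written as c e with c in \<open>C\<close> and
  e in \<open>B\<close>, then e^-1 is a value, because a e^-1 lies in \<open>C\<close>.\<close>

lemma tr_exists:
  assumes "x \<in> A <#> B" shows "\<exists>b. tr x b"
proof -
  obtain a d where x: "x = a \<otimes> d" "a \<in> A" "d \<in> B" using assms by (auto simp: mem_set_mult)
  have "a \<in> C <#> B" using subset_set_mult(1) [OF sA sB] x span by blast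
  then obtain c e where a: "a = c \<otimes> e" "c \<in> C" "e \<in> B" by (auto simp: mem_set_mult)
  have "a \<otimes> inv e = c" using a by (simp add: m_assoc)
  moreover have "inv a \<otimes> x = d" using x by simp
  moreover have "x \<in> carrier G" using x by simp
  moreover have "inv e \<in> B" using a sB by (simp add: subgroup.m_inv_closed)
  ultimately show ?thesis unfolding tr_def using x a by metis
qed

text \<open>If \<open>D\<close> is the graph of \<open>\<theta> : A/N \<rightarrow> B/N\<close>, then \<open>shift k D\<close> is the graph of \<open>\<theta> + k\<phi>\<close>.\<close>

definition shift :: "nat \<Rightarrow> 'a set \<Rightarrow> 'a set"
  where "shift k D = {x \<otimes> b [^] k | x b. x \<in> D \<and> tr x b}"

text \<open>Read modulo \<open>N\<close>, these are exactly the graphs of the homomorphisms from A/N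
  to B/N.\<close>

definition complement :: "'a set \<Rightarrow> bool"
  where "complement D \<longleftrightarrow> subgroup D G \<and> D \<inter> B = N \<and> D <#> B = A <#> B"

lemma complement_A: "complement A"
  using sA AB by (simp add: complement_def)

lemma complementD:
  assumes "complement D"
  shows "subgroup D G" "N \<subseteq> D" "center G \<subseteq> D" "D \<inter> B = N" "D <#> B = A <#> B"
    "\<And>x. x \<in> D \<Longrightarrow> x \<in> carrier G" "\<And>x. x \<in> D \<Longrightarrow> \<exists>b. tr x b"
proof -
  show *: "subgroup D G" "N \<subseteq> D" "center G \<subseteq> D" "D \<inter> B = N" "D <#> B = A <#> B"
    using assms ZN by (auto simp: complement_def)
  show "\<And>x. x \<in> D \<Longrightarrow> x \<in> carrier G" using subgroup.mem_carrier [OF *(1)] .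
  show "\<And>x. x \<in> D \<Longrightarrow> \<exists>b. tr x b"
    using tr_exists * subset_set_mult [OF *(1) sB] by blast
qed

lemma shiftI: "x \<in> D \<Longrightarrow> tr x b \<Longrightarrow> x \<otimes> b [^] k \<in> shift k D"
  by (auto simp: shift_def)

text \<open>Up to central factors, the product of x b^k and y c^k is x y (b c)^k. The central
  factors are moved into the component from \<open>D\<close>, which \<open>tr_mult_N\<close> permits
  without changing the value of phi.\<close>

lemma shift_subgroup:
  assumes D: "complement D" shows "subgroup (shift k D) G"
proof (rule subgroup_if_finite_closed)
  note D = complementD [OF D]
  show sub: "shift k D \<subseteq> carrier G"
    by (auto simp: shift_def tr_closed)
  then show "finite (shift k D)" by (rule finite_subset) simp
  have oneD: "\<one> \<in> D" using D(1) by (rule subgroup.one_closed)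
  obtain b where "tr \<one> b" using D(7) [OF oneD] ..
  then have "\<one> \<otimes> b [^] k \<in> shift k D" using oneD by (intro shiftI)
  then show "shift k D \<noteq> {}" by blast
  fix u v assume "u \<in> shift k D" "v \<in> shift k D"
  then obtain x b y c where *: "u = x \<otimes> b [^] k" "x \<in> D" "tr x b" "v = y \<otimes> c [^] k" "y \<in> D" "tr y c"
    by (auto simp: shift_def)
  note [simp] = tr_closed(1,3) [OF *(3)] tr_closed(1,3) [OF *(6)]
  obtain z where z: "z \<in> center G" "b [^] k \<otimes> c [^] k = z \<otimes> (b \<otimes> c) [^] k"
    using pow_mult_modulo [OF tr_closed(3) [OF *(3)] tr_closed(3) [OF *(6)]] by blast
  define d where "d = commutator (b [^] k) y"
  have d: "d \<in> center G" by (simp add: d_def commutator_center)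
  note [simp] = center_carrier [OF d] center_carrier [OF z(1)]
  have "u \<otimes> v = x \<otimes> (b [^] k \<otimes> y) \<otimes> c [^] k" by (simp add: * m_assoc)
  also have "\<dots> = x \<otimes> (d \<otimes> (y \<otimes> b [^] k)) \<otimes> c [^] k"
    using commutator_swap [of "b [^] k" y] by (simp add: d_def)
  also have "\<dots> = (x \<otimes> d) \<otimes> (y \<otimes> (b [^] k \<otimes> c [^] k))" by (simp add: m_assoc)
  also have "\<dots> = (d \<otimes> x) \<otimes> (y \<otimes> (z \<otimes> (b \<otimes> c) [^] k))"
    by (simp only: center_commutes [OF d tr_closed(1) [OF *(3)]] z(2))
  also have "\<dots> = (d \<otimes> x) \<otimes> ((y \<otimes> z) \<otimes> (b \<otimes> c) [^] k)" by (simp add: m_assoc)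
  also have "\<dots> = (d \<otimes> x) \<otimes> ((z \<otimes> y) \<otimes> (b \<otimes> c) [^] k)"
    by (simp only: center_commutes [OF z(1) tr_closed(1) [OF *(6)]])
  also have "\<dots> = (d \<otimes> x \<otimes> (z \<otimes> y)) \<otimes> (b \<otimes> c) [^] k" by (simp add: m_assoc)
  finally have eq: "u \<otimes> v = (d \<otimes> x \<otimes> (z \<otimes> y)) \<otimes> (b \<otimes> c) [^] k" .
  have "tr (d \<otimes> x \<otimes> (z \<otimes> y)) (b \<otimes> c)"
    using * d z ZN by (intro tr_mult tr_mult_N) auto
  moreover have "d \<otimes> x \<otimes> (z \<otimes> y) \<in> D"
    using D(3) d z * by (intro subgroup.m_closed [OF D(1)]) auto
  ultimately show "u \<otimes> v \<in> shift k D" unfolding eq by (intro shiftI)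
qed

lemma pow_B: "b \<in> B \<Longrightarrow> b [^] (k::nat) \<in> B" and pow_N: "b \<in> N \<Longrightarrow> b [^] (k::nat) \<in> N"
  using pow_closed_subgroup sB sN by blast+

text \<open>Elements of \<open>D\<close> are changed only by factors from \<open>B\<close>, so the
  product with \<open>B\<close> stays the same. If x b^k lies in \<open>B\<close>, then x lies in
  \<open>D \<inter> B = N\<close>, where phi vanishes, so b lies in \<open>N\<close> too.\<close>

lemma complement_shift:
  assumes "complement D" shows "complement (shift k D)"
proof -
  note D = complementD [OF assms]
  note sS = shift_subgroup [OF assms, of k]
  have "N \<subseteq> shift k D"
  proof
    fix n assume "n \<in> N"
    then have "n \<in> D" "tr n \<one>"
      using D(2) N_sub(2) tr_N subgroup.one_closed [OF sN] by blast+
    then have "n \<otimes> \<one> [^] k \<in> shift k D" by (rule shiftI)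
    then show "n \<in> shift k D" using \<open>n \<in> N\<close> by simp
  qed
  moreover have "shift k D \<inter> B \<subseteq> N"
  proof
    fix y assume y: "y \<in> shift k D \<inter> B"
    then obtain x b where *: "y = x \<otimes> b [^] k" "x \<in> D" "tr x b" by (auto simp: shift_def)
    then have b: "b [^] k \<in> B" using pow_B tr_closed(2) by simp
    have "x = y \<otimes> inv (b [^] k)" using tr_closed(1,3) [OF *(3)] by (simp add: *(1) m_assoc)
    then have "x \<in> B" using y b sB by (simp add: subgroup.m_closed subgroup.m_inv_closed)
    then have "x \<in> N" "b \<in> N" using *(2) D(4) tr_B [OF *(3)] by auto
    then show "y \<in> N" unfolding *(1) by (intro subgroup.m_closed [OF sN] pow_N)
  qed
  ultimately have 1: "shift k D \<inter> B = N" using N_sub by blast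
  have 2: "shift k D <#> B \<subseteq> D <#> B"
  proof
    fix y assume "y \<in> shift k D <#> B"
    then obtain x b c where *: "y = x \<otimes> b [^] k \<otimes> c" "x \<in> D" "tr x b" "c \<in> B"
      by (auto simp: shift_def mem_set_mult)
    moreover have "b [^] k \<otimes> c \<in> B"
      using * tr_closed(2) [OF *(3)] by (intro subgroup.m_closed [OF sB] pow_B)
    moreover have "y = x \<otimes> (b [^] k \<otimes> c)"
      using tr_closed(1,3) [OF *(3)] *(4) by (simp add: *(1) m_assoc)
    ultimately show "y \<in> D <#> B" unfolding mem_set_mult by blast
  qed
  have 3: "D <#> B \<subseteq> shift k D <#> B"
  proof
    fix y assume "y \<in> D <#> B"
    then obtain x c where *: "y = x \<otimes> c" "x \<in> D" "c \<in> B"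
      by (auto simp: mem_set_mult)
    obtain b where b: "tr x b" using D(7) [OF *(2)] by blast
    then have "y = (x \<otimes> b [^] k) \<otimes> (inv (b [^] k) \<otimes> c)"
      using tr_closed(1,3) [OF b] *(3) by (simp add: *(1) m_assoc)
    moreover have "inv (b [^] k) \<otimes> c \<in> B"
      using * pow_B tr_closed(2) [OF b] sB by (simp add: subgroup.m_closed subgroup.m_inv_closed)
    ultimately show "y \<in> shift k D <#> B" unfolding mem_set_mult using shiftI [OF *(2) b] by blast
  qed
  show ?thesis unfolding complement_def using 1 2 3 D(5) sS by auto
qed

text \<open>All complements have the same order, which turns inclusions between them into
  equalities.\<close>

lemma card_complement:
  assumes "complement D" shows "card D * card B = card (A <#> B) * card N"
  using complementD [OF assms] card_set_mult_Int [of D B] sB by simp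

lemma shift_subset: "complement D \<Longrightarrow> shift k D \<subseteq> A <#> B"
  using complementD(1,5) complement_shift subset_set_mult(1) sB by metis

text \<open>Shifts add because phi takes the same value at x b^k as at x, vanishing on
  \<open>B\<close>. One inclusion suffices, both sides being complements.\<close>

lemma shift_shift:
  assumes "complement D" shows "shift j (shift k D) = shift (k + j) D"
proof -
  note D = complementD [OF assms]
  have sub: "shift j (shift k D) \<subseteq> shift (k + j) D"
  proof
    fix u assume "u \<in> shift j (shift k D)"
    then obtain x b c where *: "u = x \<otimes> b [^] k \<otimes> c [^] j" "x \<in> D" "tr x b" "tr (x \<otimes> b [^] k) c"
      by (auto simp: shift_def)
    note [simp] = tr_closed(1,3) [OF *(3)] tr_closed(3) [OF *(4)]
    have "tr (b [^] k) \<one>"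
      by (intro tr_N pow_B tr_closed(2) [OF *(3)] subgroup.one_closed [OF sN])
    then have "tr (x \<otimes> b [^] k) (b \<otimes> \<one>)" by (rule tr_mult [OF *(3)])
    then have "tr (x \<otimes> b [^] k) b" by simp
    \<comment> \<open>Both b and c represent phi at x b^k. Their discrepancy n in \<open>N\<close>
      is absorbed into the component from \<open>D\<close>, together with the central factors that
      arise on the way.\<close>
    then have n: "inv b \<otimes> c \<in> N" using *(4) by (rule tr_unique)
    define n where "n = inv b \<otimes> c"
    have nN: "n \<in> N" and c: "c = b \<otimes> n" using n by (simp_all add: n_def)
    note [simp] = line_carrier(4) [OF nN]
    obtain z where z: "z \<in> center G" "(b \<otimes> n) [^] j = z \<otimes> (b [^] j \<otimes> n [^] j)"
      using pow_mult_center [OF tr_closed(3) [OF *(3)] line_carrier(4) [OF nN]] by blast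
    define d where "d = commutator (b [^] (k + j)) (n [^] j)"
    have d: "d \<in> center G" by (simp add: d_def commutator_center)
    note [simp] = center_carrier [OF d] center_carrier [OF z(1)]
    have "u = x \<otimes> (b [^] k \<otimes> z) \<otimes> (b [^] j \<otimes> n [^] j)" unfolding *(1) c z(2) by (simp add: m_assoc)
    also have "\<dots> = x \<otimes> (z \<otimes> b [^] k) \<otimes> (b [^] j \<otimes> n [^] j)"
      by (simp only: center_commutes [OF z(1) nat_pow_closed [OF tr_closed(3) [OF *(3)]]])
    also have "\<dots> = x \<otimes> z \<otimes> (b [^] (k + j) \<otimes> n [^] j)"
      by (simp add: m_assoc nat_pow_mult [symmetric] del: nat_pow_mult)
    also have "\<dots> = x \<otimes> z \<otimes> (d \<otimes> (n [^] j \<otimes> b [^] (k + j)))"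
      unfolding d_def by (subst commutator_swap) simp_all
    also have "\<dots> = (x \<otimes> (z \<otimes> d \<otimes> n [^] j)) \<otimes> b [^] (k + j)" by (simp add: m_assoc)
    finally have u: "u = (x \<otimes> (z \<otimes> d \<otimes> n [^] j)) \<otimes> b [^] (k + j)" .
    have m: "z \<otimes> d \<otimes> n [^] j \<in> N"
      using subsetD [OF ZN z(1)] subsetD [OF ZN d] pow_N [OF nN] by (simp add: subgroup.m_closed [OF sN])
    then have "tr (z \<otimes> d \<otimes> n [^] j) \<one>"
      by (intro tr_N subgroup.one_closed [OF sN] subsetD [OF N_sub(2)])
    then have "tr (x \<otimes> (z \<otimes> d \<otimes> n [^] j)) (b \<otimes> \<one>)" by (rule tr_mult [OF *(3)])
    then have "tr (x \<otimes> (z \<otimes> d \<otimes> n [^] j)) b" by simp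
    moreover have "x \<otimes> (z \<otimes> d \<otimes> n [^] j) \<in> D"
      using *(2) subsetD [OF D(2) m] by (rule subgroup.m_closed [OF D(1)])
    ultimately show "u \<in> shift (k + j) D" unfolding u by (intro shiftI)
  qed
  have c1: "complement (shift j (shift k D))" "complement (shift (k + j) D)"
    by (intro complement_shift assms)+
  have "card (shift j (shift k D)) * card B = card (shift (k + j) D) * card B"
    using card_complement c1 by simp
  then have "card (shift j (shift k D)) = card (shift (k + j) D)"
    using card_subgroup_pos [OF sB] by simp
  then show ?thesis
    using sub finite_subgroup [OF complementD(1) [OF c1(2)]] by (intro card_subset_eq)
qed

lemma shift_0:
  assumes "complement D" shows "shift 0 D = D"
proof
  note D = complementD [OF assms]
  show "shift 0 D \<subseteq> D" using D(6) by (auto simp: shift_def)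
  show "D \<subseteq> shift 0 D"
  proof
    fix x assume x: "x \<in> D"
    obtain b where "tr x b" using D(7) [OF x] ..
    then have "x \<otimes> b [^] (0::nat) \<in> shift 0 D" using x by (intro shiftI)
    then show "x \<in> shift 0 D" using D(6) [OF x] by simp
  qed
qed

lemma shift_eq_self:
  assumes D: "complement D" and B: "\<And>b. b \<in> B \<Longrightarrow> b [^] k \<in> N"
  shows "shift k D = D"
proof -
  have "shift k D \<subseteq> D"
  proof
    fix y assume "y \<in> shift k D"
    then obtain x b where "y = x \<otimes> b [^] k" "x \<in> D" "tr x b" by (auto simp: shift_def)
    then show "y \<in> D"
      using B [OF tr_closed(2)] complementD(2) [OF D]
      by (auto intro: subgroup.m_closed [OF complementD(1) [OF D]])
  qed
  moreover have "card (shift k D) * card B = card D * card B"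
    using card_complement D complement_shift by simp
  ultimately show ?thesis
    using card_subgroup_pos [OF sB] complementD(1) [OF D] by (simp add: card_subset_eq)
qed

text \<open>If theta + k phi = theta, then k phi = 0. To read this off at a, replace a by the
  element d of \<open>D\<close> in the same coset modulo \<open>B\<close>: phi has the same value b
  there, so b^k is a quotient of two elements of \<open>D\<close>.\<close>

lemma shift_fixed:
  assumes D: "complement D" and fixed: "shift k D = D" and a: "a \<in> A" "b \<in> B" "a \<otimes> b \<in> C"
  shows "b [^] k \<in> N"
proof -
  note DD = complementD [OF D]
  have tra: "tr a b"
    unfolding tr_def using a subgroup.one_closed [OF sB] by (auto intro!: bexI [of _ a])
  have "a \<in> D <#> B" using a(1) subset_set_mult(1) [OF sA sB] DD(5) by auto
  then obtain d e where de: "a = d \<otimes> e" "d \<in> D" "e \<in> B" by (auto simp: mem_set_mult)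
  have "inv e \<in> B" using de sB by (simp add: subgroup.m_inv_closed)
  then have "tr (inv e) \<one>" by (intro tr_N subgroup.one_closed [OF sN])
  then have "tr (a \<otimes> inv e) (b \<otimes> \<one>)" by (rule tr_mult [OF tra])
  then have "tr d b" using de(2,3) DD(6) a(2) by (simp add: de(1) m_assoc)
  then have "d \<otimes> b [^] k \<in> D" using shiftI [OF de(2), of b k] fixed by simp
  then have "inv d \<otimes> (d \<otimes> b [^] k) \<in> D"
    using de DD(1) by (simp add: subgroup.m_closed subgroup.m_inv_closed)
  then have "b [^] k \<in> D" using DD(6) [OF de(2)] a(2) by simp
  moreover have "b [^] k \<in> B" using a(2) by (rule pow_B)
  ultimately show ?thesis using DD(4) by blast
qed

end

text \<open>With \<open>x = a \<beta>\<close> and \<open>y = a' \<beta>'\<close>, the commutator of \<open>x b\<^sup>k\<close> and \<open>y c\<^sup>k\<close> is the \<open>k\<close>-th power of that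
  of \<open>a b \<in> C\<close> and \<open>a' c \<in> C'\<close>.\<close>

lemma (in class2_group) shift_commute:
  assumes l: "line G A B C N" and l': "line G A' B' C' N'"
    and comp: "line.complement G A B N D"
    and cent: "A' \<subseteq> centralizer G A" "B' \<subseteq> centralizer G B" "C' \<subseteq> centralizer G C"
      "D' \<subseteq> centralizer G D" "D' \<subseteq> carrier G"
  shows "line.shift G A' B' C' k D' \<subseteq> centralizer G (line.shift G A B C k D)"
proof -
  interpret l: line G A B C N by fact
  interpret l': line G A' B' C' N' by fact
  have one: "commutator x y = \<one>" if "x \<in> X" "y \<in> Y" "Y \<subseteq> centralizer G X" "X \<subseteq> carrier G" for x y X Y
    using that by (subst commutator_eq_one_iff) (auto simp: centralizer_def subset_iff)
  have DG: "D \<subseteq> carrier G" using l.complementD(1) [OF comp] by (rule subgroup.subset)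
  have key: "(x \<otimes> b [^] k) \<otimes> (y \<otimes> c [^] k) = (y \<otimes> c [^] k) \<otimes> (x \<otimes> b [^] k)"
    if x: "x \<in> D" "l.tr x b" and y: "y \<in> D'" "l'.tr y c" for x b y c
  proof -
    obtain a where a: "a \<in> A" "a \<otimes> b \<in> C" "inv a \<otimes> x \<in> B" using x by (auto simp: l.tr_def)
    obtain a' where a': "a' \<in> A'" "a' \<otimes> c \<in> C'" "inv a' \<otimes> y \<in> B'" using y by (auto simp: l'.tr_def)
    have bc: "b \<in> B" "c \<in> B'" using x y by (auto simp: l.tr_def l'.tr_def)
    have [simp]: "a \<in> carrier G" "a' \<in> carrier G" "b \<in> carrier G" "c \<in> carrier G"
      "x \<in> carrier G" "y \<in> carrier G"
      using a a' bc x y DG cent by auto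
    note sub = subgroup.subset [OF l.sA] subgroup.subset [OF l.sB] subgroup.subset [OF l.sC]
    have AA: "commutator a a' = \<one>" using one a a' cent sub by blast
    have BB: "commutator b c = \<one>" using one bc cent sub by blast
    have "commutator (a \<otimes> b) (a' \<otimes> c) = \<one>" using one a a' cent sub by blast
    \<comment> \<open>By bilinearity, the commuting of a b and a' c reduces to the two mixed
      commutators; this is the linear condition on the pair of maps.\<close>
    then have CC: "commutator b a' \<otimes> commutator a c = \<one>"
      using AA BB by (simp add: commutator_mult_left commutator_mult_right)
    have comm: "commutator b a' \<otimes> commutator a c = commutator a c \<otimes> commutator b a'"
      by (rule center_commutes) (simp_all add: commutator_center)
    have DD: "commutator x y = \<one>" using one x y cent DG by blast
    have "commutator x c = commutator (a \<otimes> (inv a \<otimes> x)) c" by simp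
    also have "\<dots> = commutator a c \<otimes> commutator (inv a \<otimes> x) c"
      by (rule commutator_mult_left) simp_all
    also have "commutator (inv a \<otimes> x) c = \<one>" using one a bc cent sub by blast
    finally have 1: "commutator x c = commutator a c" by simp
    have "commutator b y = commutator b (a' \<otimes> (inv a' \<otimes> y))" by simp
    also have "\<dots> = commutator b a' \<otimes> commutator b (inv a' \<otimes> y)"
      by (rule commutator_mult_right) simp_all
    also have "commutator b (inv a' \<otimes> y) = \<one>" using one a' bc cent sub by blast
    finally have 2: "commutator b y = commutator b a'" by simp
    \<comment> \<open>Of the four factors of the expansion, that of x and y is trivial, and so is
      that of b and c, the only one in which k would occur squared.\<close>
    have "commutator (x \<otimes> b [^] k) (y \<otimes> c [^] k) =
      commutator b a' [^] k \<otimes> commutator a c [^] k"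
      using DD BB 1 2
      by (simp add: commutator_mult_left commutator_mult_right commutator_pow_left commutator_pow_right)
    also have "\<dots> = (commutator b a' \<otimes> commutator a c) [^] k"
      by (rule pow_mult_distrib [OF comm, symmetric]) simp_all
    also have "\<dots> = \<one>" unfolding CC by simp
    finally show ?thesis by (subst (asm) commutator_eq_one_iff) simp_all
  qed
  show ?thesis
  proof
    fix v assume "v \<in> l'.shift k D'"
    then obtain y c where v: "v = y \<otimes> c [^] k" "y \<in> D'" "l'.tr y c" by (auto simp: l'.shift_def)
    then have "v \<in> carrier G" by (auto simp: l'.tr_closed)
    moreover have "v \<otimes> u = u \<otimes> v" if "u \<in> l.shift k D" for u
      using that key [OF _ _ v(2,3)] by (auto simp: l.shift_def v(1))
    ultimately show "v \<in> centralizer G (l.shift k D)" by (auto simp: centralizer_def)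
  qed
qed

section \<open>Atoms\<close>

locale cd_group = finite_group +
  assumes top_CD: "carrier G \<in> CD G"
begin

lemma center_CD: "center G \<in> CD G"
  unfolding center_def using CD_centralizer(1) [OF top_CD] .

lemma centralizer_center: "centralizer G (center G) = carrier G"
  unfolding center_def using CD_centralizer(2) [OF top_CD] .

text \<open>\<open>center G\<close> is the least member of \<open>CD G\<close> by
  \<open>center_subset_CD\<close>, so it serves as the bottom here.\<close>

definition atom :: "'a set \<Rightarrow> bool"
  where "atom A \<longleftrightarrow> A \<in> CD G \<and> A \<noteq> center G \<and> (\<forall>H\<in>CD G. H \<subseteq> A \<longrightarrow> H = center G \<or> H = A)"

lemma atomD:
  assumes "atom A"
  shows "A \<in> CD G" "A \<noteq> center G" "subgroup A G" "center G \<subseteq> A"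
    "\<And>H. H \<in> CD G \<Longrightarrow> H \<subseteq> A \<Longrightarrow> H = center G \<or> H = A"
  using assms center_subset_CD by (auto simp: atom_def CD_def)

definition conjugate :: "'a \<Rightarrow> 'a set \<Rightarrow> 'a set"
  where "conjugate g H = (\<lambda>x. g \<otimes> x \<otimes> inv g) ` H"

lemma conjugate_subgroup:
  assumes "g \<in> carrier G" "subgroup H G"
  shows "subgroup (conjugate g H) G" "card (conjugate g H) = card H"
proof -
  note [simp] = subgroup.mem_carrier [OF assms(2)] assms(1)
  have "g \<otimes> x \<otimes> inv g \<otimes> (g \<otimes> y \<otimes> inv g) = g \<otimes> (x \<otimes> y) \<otimes> inv g" if "x \<in> H" "y \<in> H" for x y
    using that by (simp add: m_assoc)
  then show "subgroup (conjugate g H) G"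
    using subgroup.one_closed [OF assms(2)] subgroup.m_closed [OF assms(2)] finite_subgroup [OF assms(2)]
    unfolding conjugate_def by (intro subgroup_if_finite_closed) auto
  have "inj_on (\<lambda>x. g \<otimes> x \<otimes> inv g) H"
    by (rule inj_onI) simp
  then show "card (conjugate g H) = card H" unfolding conjugate_def by (rule card_image)
qed

text \<open>Conjugation maps the centralizer of \<open>H\<close> into that of the conjugate and
  preserves orders, so the measure does not drop.\<close>

lemma conjugate_CD:
  assumes g: "g \<in> carrier G" and H: "H \<in> CD G"
  shows "conjugate g H \<in> CD G"
proof (rule CD_I)
  note sH = CD_subgroup [OF H] and sC = CD_centralizer_subgroup [OF H]
  show sS: "subgroup (conjugate g H) G" using g sH by (rule conjugate_subgroup)
  have "conjugate g (centralizer G H) \<subseteq> centralizer G (conjugate g H)"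
  proof
    fix y assume "y \<in> conjugate g (centralizer G H)"
    then obtain x where x: "x \<in> centralizer G H" and y: "y = g \<otimes> x \<otimes> inv g"
      by (auto simp: conjugate_def)
    then have xG: "x \<in> carrier G" by (simp add: centralizer_def)
    have "y \<otimes> (g \<otimes> h \<otimes> inv g) = (g \<otimes> h \<otimes> inv g) \<otimes> y" if h: "h \<in> H" for h
    proof -
      have hG: "h \<in> carrier G" using sH h by (rule subgroup.mem_carrier)
      have "y \<otimes> (g \<otimes> h \<otimes> inv g) = g \<otimes> (x \<otimes> h) \<otimes> inv g" using g xG hG by (simp add: y m_assoc)
      also have "x \<otimes> h = h \<otimes> x" using x h by (simp add: centralizer_def)
      also have "g \<otimes> (h \<otimes> x) \<otimes> inv g = (g \<otimes> h \<otimes> inv g) \<otimes> y" using g xG hG by (simp add: y m_assoc)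
      finally show ?thesis .
    qed
    then show "y \<in> centralizer G (conjugate g H)"
      using g xG by (auto simp: centralizer_def conjugate_def y)
  qed
  moreover have "subgroup (centralizer G (conjugate g H)) G"
    using sS by (simp add: centralizer_subgroup subgroup.subset)
  ultimately have "card (centralizer G H) \<le> card (centralizer G (conjugate g H))"
    using conjugate_subgroup(2) [OF g sC] card_mono finite_subgroup by metis
  then show "max_cd_measure G \<le> card (conjugate g H) * card (centralizer G (conjugate g H))"
    unfolding conjugate_subgroup(2) [OF g sH] CD_card [OF H, symmetric] by simp
qed

text \<open>If \<open>M\<close> is maximal in \<open>CD G - {G}\<close> and \<open>M\<^sup>g \<noteq> M\<close>, then \<open>G = M M\<^sup>g\<close>, which puts \<open>g\<close> in \<open>M\<close>.
  Centralizers exchange such \<open>M\<close> with the atoms.\<close>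

lemma atom_normal:
  assumes A: "atom A" and x: "x \<in> A" and g: "g \<in> carrier G"
  shows "g \<otimes> x \<otimes> inv g \<in> A"
proof -
  note A = atomD [OF A]
  define M where "M = centralizer G A"
  have M: "M \<in> CD G" and CM: "centralizer G M = A"
    using CD_centralizer [OF A(1)] by (simp_all add: M_def)
  note sM = CD_subgroup [OF M]
  note [simp] = subgroup.mem_carrier [OF sM]
  have max: "H = carrier G \<or> H = M" if H: "H \<in> CD G" "M \<subseteq> H" for H
  proof -
    have "centralizer G H \<subseteq> A" using H(2) CM centralizer_anti by blast
    then have "centralizer G H = center G \<or> centralizer G H = A"
      using A(5) CD_centralizer(1) [OF H(1)] by blast
    then have "H = centralizer G (center G) \<or> H = M"
      using CD_centralizer(2) [OF H(1)] M_def by auto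
    then show ?thesis by (simp add: centralizer_center)
  qed
  have conj: "conjugate g M \<subseteq> M" if g: "g \<in> carrier G" for g
  proof -
    note C = conjugate_CD [OF g M]
    note sC = CD_subgroup [OF C]
    have "M <#> conjugate g M = carrier G \<or> M <#> conjugate g M = M"
      using max CD_Int_set_mult(2) [OF M C] subset_set_mult(1) [OF sM sC] by blast
    then show ?thesis
    proof
      assume "M <#> conjugate g M = M"
      then show ?thesis using subset_set_mult(2) [OF sM sC] by simp
    next
      assume "M <#> conjugate g M = carrier G"
      then have "inv g \<in> M <#> conjugate g M" using g by simp
      then obtain m m' where m: "m \<in> M" "m' \<in> M" "inv g = m \<otimes> (g \<otimes> m' \<otimes> inv g)"
        by (auto simp: mem_set_mult conjugate_def)
      then have "\<one> = m \<otimes> (g \<otimes> m' \<otimes> inv g) \<otimes> g" using g by (metis l_inv)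
      also have "\<dots> = m \<otimes> g \<otimes> m'" using m(1,2) g by (simp add: m_assoc)
      finally have "\<one> = m \<otimes> g \<otimes> m'" .
      then have "inv m \<otimes> \<one> \<otimes> inv m' = inv m \<otimes> (m \<otimes> g \<otimes> m') \<otimes> inv m'" by simp
      then have "g = inv m \<otimes> inv m'" using m(1,2) g by (simp add: m_assoc)
      then have gM: "g \<in> M" using m sM by (simp add: subgroup.m_closed subgroup.m_inv_closed)
      show ?thesis
        unfolding conjugate_def using gM sM
        by (auto intro!: subgroup.m_closed [OF sM] subgroup.m_inv_closed [OF sM])
    qed
  qed
  have xC: "x \<in> centralizer G M" using x CM by simp
  then have xG: "x \<in> carrier G" by (simp add: centralizer_def)
  have "g \<otimes> x \<otimes> inv g \<otimes> h = h \<otimes> (g \<otimes> x \<otimes> inv g)" if h: "h \<in> M" for h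
  proof -
    have "inv g \<otimes> h \<otimes> inv (inv g) \<in> M"
      using conj [of "inv g"] g h by (auto simp: conjugate_def)
    then have "inv g \<otimes> h \<otimes> g \<in> M" using g by simp
    then have e: "x \<otimes> (inv g \<otimes> h \<otimes> g) = (inv g \<otimes> h \<otimes> g) \<otimes> x" using xC by (simp add: centralizer_def)
    have "g \<otimes> x \<otimes> inv g \<otimes> h = g \<otimes> (x \<otimes> (inv g \<otimes> h \<otimes> g)) \<otimes> inv g"
      using g xG h by (simp add: m_assoc)
    also have "\<dots> = h \<otimes> (g \<otimes> x \<otimes> inv g)" unfolding e using g xG h by (simp add: m_assoc)
    finally show ?thesis .
  qed
  then have "g \<otimes> x \<otimes> inv g \<in> centralizer G M" using g xG by (simp add: centralizer_def)
  then show ?thesis by (simp add: CM)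
qed

lemma atoms_Int: "atom A \<Longrightarrow> atom B \<Longrightarrow> A \<noteq> B \<Longrightarrow> A \<inter> B = center G"
  using CD_Int_set_mult(1) [of A B] atomD(1) [of A] atomD(1) [of B] atomD(5) [of A "A \<inter> B"]
    atomD(5) [of B "A \<inter> B"] atomD(2) [of A] by (metis inf.cobounded1 inf.cobounded2)

lemma atoms_commute:
  assumes "atom A" "atom B" "A \<noteq> B" "x \<in> A" "y \<in> B"
  shows "commutator x y \<in> center G"
proof -
  note A = atomD(3) [OF assms(1)] and B = atomD(3) [OF assms(2)]
  have G: "x \<in> carrier G" "y \<in> carrier G"
    using subgroup.mem_carrier [OF A assms(4)] subgroup.mem_carrier [OF B assms(5)] .
  have "commutator x y = (x \<otimes> y \<otimes> inv x) \<otimes> inv y"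
    using G by (simp add: commutator_def inv_mult_group m_assoc)
  also have "\<dots> \<in> B"
    by (rule subgroup.m_closed [OF B atom_normal [OF assms(2,5) G(1)] subgroup.m_inv_closed [OF B assms(5)]])
  finally have 1: "commutator x y \<in> B" .
  have "commutator x y = x \<otimes> (y \<otimes> inv x \<otimes> inv y)"
    using G by (simp add: commutator_def inv_mult_group m_assoc)
  also have "\<dots> \<in> A"
    by (rule subgroup.m_closed [OF A assms(4) atom_normal [OF assms(1) subgroup.m_inv_closed [OF A assms(4)] G(2)]])
  finally show ?thesis using 1 atoms_Int assms(1-3) by blast
qed

text \<open>The preimage in \<open>G\<close> of the centralizer of the image of \<open>X\<close> in
  G/Z.\<close>

definition centralizer_mod :: "'a set \<Rightarrow> 'a set"
  where "centralizer_mod X = {x \<in> carrier G. \<forall>y\<in>X. commutator x y \<in> center G}"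

lemma centralizer_mod_subgroup:
  assumes "X \<subseteq> carrier G"
  shows "subgroup (centralizer_mod X) G" "center G \<subseteq> centralizer_mod X"
proof -
  note one = subgroup.one_closed [OF center_subgroup]
  have cm: "commutator z y = \<one>" if "z \<in> center G" "y \<in> carrier G" for z y
    using that by (subst commutator_eq_one_iff) (auto simp: center_commutes center_carrier)
  show Z: "center G \<subseteq> centralizer_mod X"
    using assms cm one by (auto simp: centralizer_mod_def center_carrier subset_iff)
  show "subgroup (centralizer_mod X) G"
  proof (rule subgroup_if_finite_closed)
    show sub: "centralizer_mod X \<subseteq> carrier G" by (auto simp: centralizer_mod_def)
    then show "finite (centralizer_mod X)" by (rule finite_subset) simp
    show "centralizer_mod X \<noteq> {}" using Z one by blast
    fix x y assume xy: "x \<in> centralizer_mod X" "y \<in> centralizer_mod X"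
    have "commutator (x \<otimes> y) w \<in> center G" if w: "w \<in> X" for w
    proof -
      have "commutator (x \<otimes> y) w = commutator x w \<otimes> commutator y w"
        using xy w assms by (intro commutator_mult_central) (auto simp: centralizer_mod_def)
      then show ?thesis
        using xy w by (simp add: centralizer_mod_def subgroup.m_closed [OF center_subgroup])
    qed
    then show "x \<otimes> y \<in> centralizer_mod X" using xy by (simp add: centralizer_mod_def)
  qed
qed

end

text \<open>These are the facts about the subgroup lattice of \<open>E\<close> on which the argument
  rests. In \<open>card_line\<close> the atom \<open>B\<close> is left out because it is the only
  atom of the line that is not a graph over \<open>A\<close>; the remaining p atoms are those that
  the shifts permute.\<close>

locale cd_projective = cd_group +
  fixes p :: nat
  assumes p: "prime p"
    and atoms_separate: "H \<in> CD G \<Longrightarrow> K \<in> CD G \<Longrightarrow> \<not> H \<subseteq> K \<Longrightarrow> \<exists>A. atom A \<and> A \<subseteq> H \<and> \<not> A \<subseteq> K"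
    and card_line: "atom A \<Longrightarrow> atom B \<Longrightarrow> A \<noteq> B \<Longrightarrow> card {C. atom C \<and> C \<subseteq> A <#> B \<and> C \<noteq> B} = p"
    and other_atom: "atom A \<Longrightarrow> \<exists>B. atom B \<and> B \<noteq> A"
begin

text \<open>A largest member of \<open>CD G\<close> inside \<open>N\<close> must be
  \<open>G\<close>, since it could otherwise be multiplied by an atom outside it. \<open>N\<close>
  is just a subgroup, so this applies to centralizers modulo Z and to the elements with central p-th
  power.\<close>

lemma atoms_generate:
  assumes N: "subgroup N G" "center G \<subseteq> N" and atoms: "\<And>A. atom A \<Longrightarrow> A \<subseteq> N"
  shows "N = carrier G"
proof -
  define S where "S = {H \<in> CD G. H \<subseteq> N}"
  have "finite S"
    by (rule finite_subset [OF _ finite_subgroups]) (auto simp: S_def CD_def)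
  moreover have "S \<noteq> {}" using center_CD N by (auto simp: S_def)
  ultimately have "Max (card ` S) \<in> card ` S" "\<And>K. K \<in> S \<Longrightarrow> card K \<le> Max (card ` S)"
    by simp_all
  then obtain H where H: "H \<in> S" and max: "\<And>K. K \<in> S \<Longrightarrow> card K \<le> card H"
    by (metis imageE)
  have HS: "H \<in> CD G" "H \<subseteq> N" using H by (auto simp: S_def)
  have "carrier G \<subseteq> H"
  proof (rule ccontr)
    assume "\<not> carrier G \<subseteq> H"
    then obtain A where A: "atom A" "\<not> A \<subseteq> H" using atoms_separate top_CD HS by blast
    note AD = atomD [OF A(1)]
    have HA: "H <#> A \<in> S"
      using CD_Int_set_mult(2) [OF HS(1) AD(1)] set_mult_least [OF N(1) HS(2) atoms [OF A(1)]]
      by (simp add: S_def)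
    have sub: "H \<subseteq> H <#> A" "A \<subseteq> H <#> A"
      using subset_set_mult CD_subgroup HS(1) AD(3) by blast+
    have "finite (H <#> A)" using HA CD_subgroup by (auto simp: S_def)
    then have "H = H <#> A" using max [OF HA] sub(1) by (intro card_seteq)
    then show False using A(2) sub(2) by blast
  qed
  then show ?thesis using HS(2) N(1) subgroup.subset by blast
qed

text \<open>The exchange property of the geometry, obtained by counting with the product
  formula.\<close>

lemma line_replace:
  assumes A: "atom A" and B: "atom B" and C: "atom C"
    and ne: "A \<noteq> B" "C \<noteq> B" and sub: "C \<subseteq> A <#> B"
  shows "C <#> B = A <#> B" "card C = card A"
proof -
  note A' = atomD [OF A] and B' = atomD [OF B] and C' = atomD [OF C]
  have AB: "A <#> B \<in> CD G" and CB: "C <#> B \<in> CD G"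
    using CD_Int_set_mult(2) A'(1) B'(1) C'(1) by blast+
  note sAB = CD_subgroup [OF AB] and sCB = CD_subgroup [OF CB]
  note inAB = subset_set_mult [OF A'(3) B'(3)] and inCB = subset_set_mult [OF C'(3) B'(3)]
  have le: "C <#> B \<subseteq> A <#> B" using sAB sub inAB(2) by (rule set_mult_least)
  have z: "card (center G) > 0" using center_subgroup by (rule card_subgroup_pos)
  have cAB: "card (A <#> B) * card (center G) = card A * card B"
    using card_set_mult_Int [OF A'(3) B'(3)] atoms_Int [OF A B ne(1)] by simp
  have cCB: "card (C <#> B) * card (center G) = card C * card B"
    using card_set_mult_Int [OF C'(3) B'(3)] atoms_Int [OF C B ne(2)] by simp
  have "(C <#> B) \<inter> A = center G \<or> (C <#> B) \<inter> A = A"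
    using A'(5) CD_Int_set_mult(1) [OF CB A'(1)] by blast
  then have "A \<subseteq> C <#> B"
  proof
    \<comment> \<open>In this case CBA has order |CB| |A| / |Z| and lies in AB, whose order is |A|
      |B| / |Z|. So |CB| is at most |B|, and there is no room for \<open>C\<close> outside
      \<open>B\<close>.\<close>
    assume int: "(C <#> B) \<inter> A = center G"
    have "card ((C <#> B) <#> A) * card (center G) = card (C <#> B) * card A"
      using card_set_mult_Int [OF sCB A'(3)] int by simp
    moreover have "card ((C <#> B) <#> A) \<le> card (A <#> B)"
      using set_mult_least [OF sAB le inAB(1)] sAB by (intro card_mono) simp_all
    ultimately have "card (C <#> B) * card A \<le> card A * card B"
      using cAB by (metis mult_le_mono1)
    then have "card (C <#> B) \<le> card B" using card_subgroup_pos [OF A'(3)] by simp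
    then have "B = C <#> B" using inCB(2) sCB by (intro card_seteq) simp_all
    then have "C = center G \<or> C = B" using inCB(1) B'(5) C'(1) by blast
    then show ?thesis using ne C'(2) by blast
  qed blast
  then have "A <#> B \<subseteq> C <#> B" using sCB inCB(2) by (intro set_mult_least)
  then show eq: "C <#> B = A <#> B" using le by blast
  have "card C * card B = card A * card B" using cAB cCB unfolding eq by linarith
  then show "card C = card A" using card_subgroup_pos [OF B'(3)] by simp
qed

text \<open>Besides \<open>B\<close> the line has p atoms, and p is at least 2.\<close>

lemma third_atom:
  assumes "atom A" "atom B" "A \<noteq> B"
  shows "\<exists>C. atom C \<and> C \<subseteq> A <#> B \<and> C \<noteq> A \<and> C \<noteq> B"
proof (rule ccontr)
  assume "\<nexists>C. atom C \<and> C \<subseteq> A <#> B \<and> C \<noteq> A \<and> C \<noteq> B"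
  then have "{C. atom C \<and> C \<subseteq> A <#> B \<and> C \<noteq> B} \<subseteq> {A}" by blast
  then have "card {C. atom C \<and> C \<subseteq> A <#> B \<and> C \<noteq> B} \<le> card {A}" by (intro card_mono) auto
  then have "p \<le> 1" using card_line [OF assms] by simp
  then show False using prime_gt_1_nat [OF p] by simp
qed

lemma set_mult_CD_commute:
  assumes "H \<in> CD G" "K \<in> CD G" shows "H <#> K = K <#> H"
proof -
  have "H <#> K \<subseteq> K <#> H" if "H \<in> CD G" "K \<in> CD G" for H K
    using CD_Int_set_mult(2) [OF that(2,1)] subset_set_mult [of K H] that
    by (intro set_mult_least) (auto simp: CD_def)
  then show ?thesis using assms by blast
qed

text \<open>A third atom on the line can be exchanged for either of the two given ones, and exchange
  preserves the order.\<close>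

lemma card_atoms:
  assumes "atom A" "atom B" shows "card A = card B"
proof (cases "A = B")
  case False
  then obtain C where C: "atom C" "C \<subseteq> A <#> B" "C \<noteq> A" "C \<noteq> B" using third_atom [OF assms False] by blast
  then have "card C = card A" using line_replace(2) [of A B C] assms False by blast
  moreover have "card C = card B"
    using line_replace(2) [of B A C] assms C False set_mult_CD_commute atomD(1) by metis
  ultimately show ?thesis by simp
qed simp

lemma atom_abelian_mod_center:
  assumes A: "atom A" and xy: "x \<in> A" "y \<in> A"
  shows "commutator x y \<in> center G"
proof -
  obtain B where B: "atom B" "B \<noteq> A" using other_atom A by blast
  then obtain C where C: "atom C" "C \<subseteq> A <#> B" "C \<noteq> A" "C \<noteq> B"
    using third_atom A by metis
  have "A \<subseteq> C <#> B"
    using line_replace(1) [of A B C] A B C subset_set_mult(1) atomD(3) by metis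
  moreover have "C <#> B \<subseteq> centralizer_mod A"
    using atoms_commute A B C subgroup.subset [OF atomD(3)] centralizer_mod_subgroup(1)
    by (intro set_mult_least) (auto simp: centralizer_mod_def subset_iff)
  ultimately show ?thesis using xy by (auto simp: centralizer_mod_def)
qed

text \<open>Generation by atoms is used twice: first all of \<open>G\<close> is seen to centralize
  each atom modulo Z, and then, with the arguments swapped, the atoms and hence all of
  \<open>G\<close> centralize \<open>G\<close> modulo Z.\<close>

lemma commutator_in_center:
  assumes "x \<in> carrier G" "y \<in> carrier G"
  shows "commutator x y \<in> center G"
proof -
  have 1: "centralizer_mod A = carrier G" if A: "atom A" for A
  proof (rule atoms_generate)
    have AG: "A \<subseteq> carrier G" using atomD(3) [OF A] by (rule subgroup.subset)
    then show "subgroup (centralizer_mod A) G" "center G \<subseteq> centralizer_mod A"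
      by (rule centralizer_mod_subgroup)+
    fix B assume B: "atom B"
    then have "B \<subseteq> carrier G" using atomD(3) [OF B] by (simp add: subgroup.subset)
    then show "B \<subseteq> centralizer_mod A"
      using atoms_commute [OF B A] atom_abelian_mod_center [OF A]
      by (cases "A = B") (auto simp: centralizer_mod_def)
  qed
  have "centralizer_mod (carrier G) = carrier G"
  proof (rule atoms_generate)
    show "subgroup (centralizer_mod (carrier G)) G" "center G \<subseteq> centralizer_mod (carrier G)"
      by (rule centralizer_mod_subgroup, simp)+
    fix A assume A: "atom A"
    show "A \<subseteq> centralizer_mod (carrier G)"
    proof
      fix a assume a: "a \<in> A"
      then have aG: "a \<in> carrier G" by (rule subgroup.mem_carrier [OF atomD(3) [OF A]])
      have "commutator a g \<in> center G" if g: "g \<in> carrier G" for g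
      proof -
        have "commutator g a \<in> center G" using 1 [OF A] g a by (auto simp: centralizer_mod_def)
        then show ?thesis
          using commutator_inverse [OF g aG] subgroup.m_inv_closed [OF center_subgroup] by simp
      qed
      then show "a \<in> centralizer_mod (carrier G)" using aG by (simp add: centralizer_mod_def)
    qed
  qed
  then show ?thesis using assms by (auto simp: centralizer_mod_def)
qed

end

sublocale cd_projective \<subseteq> class2_group
  by unfold_locales (rule commutator_in_center)

section \<open>Shifted atoms and the exponent of G/Z\<close>

context cd_projective
begin

lemma atoms_line:
  assumes "atom A" "atom B" "atom C" "A \<noteq> B" "C \<noteq> B" "C \<subseteq> A <#> B"
  shows "line G A B C (center G)"
proof (rule line.intro [OF class2_group_axioms line_axioms.intro])
  show "subgroup A G" "subgroup B G" "subgroup C G" using assms by (auto intro: atomD(3))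
  show "A \<inter> B = center G" "C \<inter> B = center G" using atoms_Int assms by simp_all
  show "A <#> B = C <#> B" using line_replace(1) [OF assms] by simp
qed simp

text \<open>Duality sends the product AB to the intersection of the centralizers, and the
  intersections \<open>A \<inter> B\<close> and \<open>C \<inter> B\<close>, both equal to Z, to
  products of centralizers that are both equal to C_G(Z).\<close>

lemma atoms_line_centralizer:
  assumes "atom A" "atom B" "atom C" "A \<noteq> B" "C \<noteq> B" "C \<subseteq> A <#> B"
  shows "line G (centralizer G A) (centralizer G B) (centralizer G C) (centralizer G (A <#> B))"
proof (rule line.intro [OF class2_group_axioms line_axioms.intro])
  have cd: "A \<in> CD G" "B \<in> CD G" "C \<in> CD G" using assms atomD(1) by blast+
  note sub = CD_subgroup [OF cd(1)] CD_subgroup [OF cd(2)] CD_subgroup [OF cd(3)]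
  show "subgroup (centralizer G A) G" "subgroup (centralizer G B) G" "subgroup (centralizer G C) G"
    using cd by (auto intro: CD_centralizer_subgroup)
  show "center G \<subseteq> centralizer G (A <#> B)"
    using center_subset_CD [OF CD_centralizer(1) [OF CD_Int_set_mult(2) [OF cd(1,2)]]] .
  show "centralizer G A \<inter> centralizer G B = centralizer G (A <#> B)"
    using centralizer_set_mult sub by simp
  show "centralizer G C \<inter> centralizer G B = centralizer G (A <#> B)"
    using centralizer_set_mult [OF sub(3,2)] line_replace(1) [OF assms] by simp
  show "centralizer G A <#> centralizer G B = centralizer G C <#> centralizer G B"
    using CD_Int_set_mult(3) [OF cd(1,2)] CD_Int_set_mult(3) [OF cd(3,2)] atoms_Int assms by simp
qed

text \<open>The shift of the centralizer of \<open>D\<close> centralizes the shift S of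
  \<open>D\<close> and keeps its order, so the measure of S is at least that of \<open>D\<close>. An
  atom inside S has the common order of all atoms and therefore equals S.\<close>

lemma shift_atom:
  assumes ABC: "atom A" "atom B" "atom C" "A \<noteq> B" "C \<noteq> B" "C \<subseteq> A <#> B"
    and D: "atom D" "D \<noteq> B" "D \<subseteq> A <#> B"
  shows "line.complement G A B (center G) D"
    "atom (line.shift G A B C k D)" "line.shift G A B C k D \<noteq> B" "line.shift G A B C k D \<subseteq> A <#> B"
proof -
  interpret l: line G A B C "center G" using ABC by (rule atoms_line)
  interpret l': line G "centralizer G A" "centralizer G B" "centralizer G C" "centralizer G (A <#> B)"
    using ABC by (rule atoms_line_centralizer)
  note A' = atomD [OF ABC(1)] and B' = atomD [OF ABC(2)] and D' = atomD [OF D(1)]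
  note DB = line_replace [OF ABC(1,2) D(1) ABC(4) D(2,3)]
  show comp: "l.complement D"
    unfolding l.complement_def using D'(3) atoms_Int [OF D(1) ABC(2) D(2)] DB by simp
  note sC = CD_centralizer_subgroup [OF D'(1)]
  have comp': "l'.complement (centralizer G D)"
    unfolding l'.complement_def
    using centralizer_set_mult [OF D'(3) B'(3)] DB sC CD_Int_set_mult(3) [OF D'(1) B'(1)]
      CD_Int_set_mult(3) [OF A'(1) B'(1)] atoms_Int D(1,2) ABC by simp
  define S where "S = l.shift k D"
  define S' where "S' = l'.shift k (centralizer G D)"
  note compS = l.complement_shift [OF comp, of k, folded S_def]
  note compS' = l'.complement_shift [OF comp', of k, folded S'_def]
  note sS = l.complementD(1) [OF compS]
  have "card S * card B = card D * card B"
    using l.card_complement compS comp by simp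
  then have card_S: "card S = card D" using card_subgroup_pos [OF B'(3)] by simp
  have "card S' * card (centralizer G B) = card (centralizer G D) * card (centralizer G B)"
    using l'.card_complement compS' comp' by simp
  then have card_S': "card S' = card (centralizer G D)"
    using card_subgroup_pos [OF CD_centralizer_subgroup [OF B'(1)]] by simp
  have "S' \<subseteq> centralizer G S"
    unfolding S_def S'_def
    by (rule shift_commute [OF l.line_axioms l'.line_axioms comp subset_refl subset_refl subset_refl subset_refl])
      (rule subgroup.subset [OF sC])
  moreover have "subgroup (centralizer G S) G"
    using sS by (simp add: centralizer_subgroup subgroup.subset)
  ultimately have "card (centralizer G D) \<le> card (centralizer G S)"
    unfolding card_S' [symmetric] by (intro card_mono) simp_all
  then have "S \<in> CD G"
    using sS card_S CD_card [OF D'(1)] by (intro CD_I) (simp_all flip: CD_card [OF D'(1)])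
  moreover have "\<not> S \<subseteq> center G"
  proof
    assume "S \<subseteq> center G"
    then have "card D \<le> card (center G)" using card_S center_subgroup by (metis card_mono finite_subgroup)
    then have "center G = D" using D'(3,4) by (intro card_seteq) simp_all
    then show False using D'(2) by simp
  qed
  ultimately obtain A1 where A1: "atom A1" "A1 \<subseteq> S" using atoms_separate center_CD by blast
  have "A1 = S"
    using A1(2) card_S card_atoms [OF A1(1) D(1)] sS by (intro card_subset_eq) simp_all
  then show "atom (l.shift k D)" using A1(1) S_def by simp
  show "l.shift k D \<noteq> B"
    using l.complementD(4) [OF compS] B'(2) unfolding S_def by blast
  show "l.shift k D \<subseteq> A <#> B" using comp by (rule l.shift_subset)
qed

lemma atom_exponent:
  assumes B: "atom B" shows "\<exists>q::nat. prime q \<and> (\<forall>b\<in>B. b [^] q \<in> center G)"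
proof -
  obtain A where A: "atom A" "A \<noteq> B" using other_atom B by blast
  obtain C where C: "atom C" "C \<subseteq> A <#> B" "C \<noteq> A" "C \<noteq> B"
    using third_atom [OF A(1) B A(2)] by blast
  note A' = atomD [OF A(1)] and B' = atomD [OF B] and C' = atomD [OF C(1)]
  interpret l: line G A B C "center G" using A B C by (intro atoms_line)
  note [simp] = l.line_carrier
  obtain b where b: "b \<in> B" "b \<notin> center G" using B' by blast
  \<comment> \<open>The least k with \<open>P k\<close> is the order of b modulo Z. For a prime q
    dividing it, the power d of b has order q modulo Z.\<close>
  define P where "P k \<longleftrightarrow> k > 0 \<and> b [^] k \<in> center G" for k :: nat
  have "P (order G)"
    using b pow_order_eq_1 subgroup.one_closed [OF center_subgroup] order_gt_0_iff_finite fin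
    by (simp add: P_def)
  then have Pk: "P (LEAST k. P k)" by (rule LeastI)
  define k where "k = (LEAST k. P k)"
  have k: "k > 0" "b [^] k \<in> center G" using Pk by (auto simp: k_def P_def)
  have "k \<noteq> 1" using k(2) b by (auto simp: nat_pow_eone)
  then obtain q where q: "prime q" "q dvd k" using prime_factor_nat by blast
  obtain j where j: "k = j * q" using q(2) by (metis dvd_div_mult_self)
  have "j > 0" "j < k" using k(1) j prime_gt_1_nat [OF q(1)] by (auto intro: gr0I)
  then have jZ: "b [^] j \<notin> center G" using not_less_Least [of j P] by (auto simp: k_def P_def)
  define d where "d = b [^] j"
  have d: "d \<in> B" "d \<notin> center G" "d [^] q \<in> center G"
    using b jZ k(2) j l.pow_B by (auto simp: d_def nat_pow_pow)
  have dG [simp]: "d \<in> carrier G" using d by simp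
  note shift = shift_atom(2) [OF A(1) B C(1) A(2) C(4,2) A(1) A(2) subset_set_mult(1) [OF A'(3) B'(3)], of q]
  \<comment> \<open>\<open>A\<close> and \<open>C\<close> span the same line, which makes phi
    surjective: d = a c says that d is a value of phi at a^-1.\<close>
  have BAC: "B \<subseteq> A <#> C"
    using line_replace(1) [of C A B] line_replace(1) [of B A C] A B C
      set_mult_CD_commute [OF A'(1) B'(1)] set_mult_CD_commute [OF A'(1) C'(1)]
      subset_set_mult(2) [OF A'(3) B'(3)] by metis
  then have "d \<in> A <#> C" using d(1) ..
  then obtain a c where ac: "d = a \<otimes> c" "a \<in> A" "c \<in> C" by (auto simp: mem_set_mult)
  have "inv a \<otimes> d = c" using ac by simp
  then have ia: "inv a \<in> A" "inv a \<otimes> d \<in> C" using ac A'(3) by (simp_all add: subgroup.m_inv_closed)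
  \<comment> \<open>The atoms \<open>A\<close> and \<open>l.shift q A\<close> share this noncentral
    element, whereas distinct atoms meet in the center only. Hence they coincide, and surjectivity
    of phi spreads the exponent q over \<open>B\<close>.\<close>
  have "inv a \<otimes> d [^] q \<in> l.shift q A"
    using ia d(1) subgroup.one_closed [OF B'(3)] by (intro l.shiftI) (auto simp: l.tr_def)
  moreover have "inv a \<otimes> d [^] q \<in> A"
    using ia d(3) A'(4) by (intro subgroup.m_closed [OF A'(3)]) auto
  moreover have "inv a \<otimes> d [^] q \<notin> center G"
  proof
    assume "inv a \<otimes> d [^] q \<in> center G"
    then have "(inv a \<otimes> d [^] q) \<otimes> inv (d [^] q) \<in> center G"
      using d(3) by (rule subgroup.m_closed [OF center_subgroup _ subgroup.m_inv_closed [OF center_subgroup]])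
    then have "inv a \<in> center G" using ac by (simp add: m_assoc)
    then have "a \<in> center G" using subgroup.m_inv_closed [OF center_subgroup] ac by force
    then have "d \<in> C" using ac C'(4) by (auto intro: subgroup.m_closed [OF C'(3)])
    then show False using d atoms_Int [OF C(1) B C(4)] by blast
  qed
  ultimately have S: "l.shift q A = A"
    using atoms_Int [OF shift A(1)] by blast
  have "e [^] q \<in> center G" if e: "e \<in> B" for e
  proof -
    have "e \<in> A <#> C" using e BAC by blast
    then obtain a c where ac: "e = a \<otimes> c" "a \<in> A" "c \<in> C" by (auto simp: mem_set_mult)
    have "inv a \<otimes> e = c" using ac by simp
    then have "inv a \<in> A" "inv a \<otimes> e \<in> C" using ac A'(3) by (simp_all add: subgroup.m_inv_closed)
    then show ?thesis using l.shift_fixed [OF l.complement_A S _ e] by blast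
  qed
  then show ?thesis using q(1) by blast
qed

lemma atom_exponent_p:
  assumes B: "atom B" and b: "b \<in> B" shows "b [^] p \<in> center G"
proof -
  obtain q :: nat where q: "prime q" and Bq: "\<And>b. b \<in> B \<Longrightarrow> b [^] q \<in> center G"
    using atom_exponent [OF B] by blast
  obtain A where A: "atom A" "A \<noteq> B" using other_atom B by blast
  obtain C where C: "atom C" "C \<subseteq> A <#> B" "C \<noteq> A" "C \<noteq> B"
    using third_atom [OF A(1) B A(2)] by blast
  note A' = atomD [OF A(1)] and B' = atomD [OF B] and C' = atomD [OF C(1)]
  interpret l: line G A B C "center G" using A B C by (intro atoms_line)
  define X where "X = {D. atom D \<and> D \<subseteq> A <#> B \<and> D \<noteq> B}"
  have cardX: "card X = p" using card_line A B by (simp add: X_def)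
  have finX: "finite X" using cardX prime_gt_0_nat [OF p] by (metis card_gt_0_iff)
  have comp: "l.complement D" and sX: "l.shift k D \<in> X" if "D \<in> X" for D k
    using shift_atom [OF A(1) B C(1) A(2) C(4,2)] that by (auto simp: X_def)
  \<comment> \<open>A witness that phi is nonzero: c = a e exhibits the noncentral e as its value at
    a^-1 up to inversion, with a e in \<open>C\<close>.\<close>
  obtain c where c: "c \<in> C" "c \<notin> center G" using C' by blast
  have cG [simp]: "c \<in> carrier G" using C'(3) c(1) by (rule subgroup.mem_carrier)
  obtain a e where ce: "c = a \<otimes> e" "a \<in> A" "e \<in> B" using subsetD [OF C(2) c(1)] by (auto simp: mem_set_mult)
  have eZ: "e \<notin> center G"
  proof
    assume "e \<in> center G"
    then have "c \<in> A" using ce A'(4) by (auto intro: subgroup.m_closed [OF A'(3)])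
    then show False using c atoms_Int [OF C(1) A(1) C(3)] by blast
  qed
  have eG: "e \<in> carrier G" using ce(3) by simp
  txt \<open>The shifts act freely and with order \<open>q\<close> on the \<open>p\<close> atoms in \<open>X\<close>, so \<open>q\<close> divides \<open>p\<close>.\<close>
  have free: "q dvd k" if D: "D \<in> X" and fixed: "l.shift k D = D" for D k
  proof (rule ccontr)
    assume "\<not> q dvd k"
    then have "coprime q k" using q by (simp add: prime_imp_coprime)
    have ek: "e [^] k \<in> center G" using l.shift_fixed [OF comp [OF D] fixed ce(2,3)] ce c by simp
    \<comment> \<open>Here u inverts k modulo q: e is the quotient of its powers with exponents k u
      and q v, both of which are central.\<close>
    obtain u v where uv: "k * u = q * v + 1"
      using \<open>coprime q k\<close> bezout_nat [of k q] prime_gt_0_nat [OF q] \<open>\<not> q dvd k\<close>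
      by (metis coprime_commute coprime_imp_gcd_eq_1 dvd_0_right neq0_conv)
    have "e [^] (k * u) = e [^] (q * v) \<otimes> e" using eG uv by (simp flip: nat_pow_mult)
    moreover have "e [^] (k * u) \<in> center G" "e [^] (q * v) \<in> center G"
      using pow_closed_subgroup [OF center_subgroup] ek Bq [OF ce(3)] eG by (simp_all flip: nat_pow_pow)
    ultimately have "inv (e [^] (q * v)) \<otimes> (e [^] (q * v) \<otimes> e) \<in> center G"
      using subgroup.m_closed [OF center_subgroup] subgroup.m_inv_closed [OF center_subgroup] by metis
    then show False using eZ eG by simp
  qed
  have period: "l.shift q D = D" if "D \<in> X" for D
    using comp [OF that] Bq by (intro l.shift_eq_self)
  have mult: "l.shift (q * j) D = D" if "D \<in> X" for D j
  proof (induction j)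
    case (Suc j)
    have "l.shift (q * Suc j) D = l.shift q (l.shift (q * j) D)"
      using l.shift_shift [OF comp [OF that], of q "q * j"] by (simp add: add.commute)
    then show ?case using Suc period [OF that] by simp
  qed (use l.shift_0 comp that in simp)
  \<comment> \<open>Shifts by residues below q already give the full orbit because of the period q,
    and freeness makes these q shifts distinct.\<close>
  define orb where "orb D = (\<lambda>k. l.shift k D) ` {..<q}" for D
  have orb: "orb D = range (\<lambda>k. l.shift k D)" if D: "D \<in> X" for D
  proof -
    have "l.shift k D \<in> orb D" for k
    proof -
      have "l.shift (q * (k div q) + k mod q) D = l.shift (k mod q) D"
        using l.shift_shift [OF comp [OF D], of "k mod q" "q * (k div q)"] mult [OF D] by simp
      then show ?thesis using prime_gt_0_nat [OF q] by (auto simp: orb_def)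
    qed
    then show ?thesis by (auto simp: orb_def)
  qed
  have orb_sym: "D \<in> orb E" if D: "D \<in> X" and E: "E \<in> X" and ED: "E \<in> orb D" for D E
  proof -
    obtain k where k: "k < q" "E = l.shift k D" using ED by (auto simp: orb_def)
    then have "l.shift (q - k) E = D"
      using l.shift_shift [OF comp [OF D], of "q - k" k] period [OF D] by simp
    then show ?thesis using orb [OF E] by blast
  qed
  have trans: "orb E \<subseteq> orb D" if D: "D \<in> X" and E: "E \<in> orb D" for D E
  proof -
    obtain k where k: "E = l.shift k D" using E by (auto simp: orb_def)
    then show ?thesis
      using l.shift_shift [OF comp [OF D]] orb [OF D] by (auto simp: orb_def)
  qed
  have orbX: "orb D \<subseteq> X" "D \<in> orb D" if "D \<in> X" for D
    using sX that l.shift_0 [OF comp [OF that]] orb [OF that] by (auto simp: orb_def)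
  have "q * card (orb ` X) = card (\<Union> (orb ` X))"
  proof (rule card_partition)
    show "finite (orb ` X)" using finX by simp
    have U: "\<Union> (orb ` X) = X" using orbX by blast
    then show "finite (\<Union> (orb ` X))" using finX by simp
    show "card c = q" if c: "c \<in> orb ` X" for c
    proof -
      obtain D where D: "D \<in> X" "c = orb D" using c by blast
      have wlog: "i = j" if "i \<le> j" "j < q" "l.shift i D = l.shift j D" for i j
      proof -
        have "l.shift (j - i) (l.shift i D) = l.shift i D"
          using l.shift_shift [OF comp [OF D(1)], of "j - i" i] that by simp
        then have "q dvd j - i" using free sX D(1) by blast
        then show ?thesis using that(1,2) by (metis diff_is_0_eq' dvd_imp_le less_imp_diff_less linorder_not_less neq0_conv le_antisym diff_is_0_eq)
      qed
      have "inj_on (\<lambda>k. l.shift k D) {..<q}"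
        by (rule inj_onI) (metis wlog lessThan_iff nat_le_linear)
      then show ?thesis using D(2) by (simp add: orb_def card_image)
    qed
    show "c1 \<inter> c2 = {}" if c: "c1 \<in> orb ` X" "c2 \<in> orb ` X" "c1 \<noteq> c2" for c1 c2
    proof (rule ccontr)
      assume "c1 \<inter> c2 \<noteq> {}"
      then obtain D1 D2 E where D: "D1 \<in> X" "c1 = orb D1" "D2 \<in> X" "c2 = orb D2" "E \<in> orb D1" "E \<in> orb D2"
        using c by blast
      then have E: "E \<in> X" using orbX by blast
      have "orb D1 = orb E" "orb D2 = orb E"
        using trans orb_sym D E by (meson subset_antisym)+
      then show False using D c by simp
    qed
  qed
  moreover have "\<Union> (orb ` X) = X" using orbX by blast
  ultimately have "q dvd p" using cardX by (metis dvd_triv_left)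
  then have "q = p" using p q by (simp add: primes_dvd_imp_eq)
  then show ?thesis using Bq b by simp
qed

text \<open>Since p-th powers are multiplicative modulo the center, the elements with central p-th
  power form a subgroup, and it contains all atoms.\<close>

lemma pow_p_center:
  assumes "x \<in> carrier G" shows "x [^] p \<in> center G"
proof -
  define N where "N = {x \<in> carrier G. x [^] p \<in> center G}"
  have "N = carrier G"
  proof (rule atoms_generate)
    show Z: "center G \<subseteq> N"
      using pow_closed_subgroup [OF center_subgroup] by (auto simp: N_def center_carrier)
    show "subgroup N G"
    proof (rule subgroup_if_finite_closed)
      show sub: "N \<subseteq> carrier G" by (auto simp: N_def)
      then show "finite N" by (rule finite_subset) simp
      show "N \<noteq> {}" using Z subgroup.one_closed [OF center_subgroup] by blast
      fix x y assume xy: "x \<in> N" "y \<in> N"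
      then obtain z where "z \<in> center G" "(x \<otimes> y) [^] p = z \<otimes> (x [^] p \<otimes> y [^] p)"
        using pow_mult_center [of x y p] by (auto simp: N_def)
      then show "x \<otimes> y \<in> N" using xy by (simp add: N_def subgroup.m_closed [OF center_subgroup])
    qed
    show "A \<subseteq> N" if "atom A" for A
      using atom_exponent_p [OF that] atomD(3) [OF that] subgroup.mem_carrier by (fastforce simp: N_def)
  qed
  then show ?thesis using assms by (auto simp: N_def)
qed

end

section \<open>Subgroup lattices of elementary abelian groups\<close>

lemma lattice_isomorphic_order:
  assumes "lattice_isomorphic X Y"
  shows "\<exists>f. bij_betw f (carrier X) (carrier Y) \<and>
    (\<forall>x\<in>carrier X. \<forall>y\<in>carrier X. le X x y \<longleftrightarrow> le Y (f x) (f y))"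
proof -
  obtain f where f: "bij_betw f (carrier X) (carrier Y)" and j: "join_pres X Y f"
    using assms by (auto simp: lattice_isomorphic_def)
  have X: "lattice X" and Y: "lattice Y"
    and h: "\<And>x y. x \<in> carrier X \<Longrightarrow> y \<in> carrier X \<Longrightarrow> f (x \<squnion>\<^bsub>X\<^esub> y) = f x \<squnion>\<^bsub>Y\<^esub> f y"
    using j by (auto simp: join_pres_def)
  have mem: "f x \<in> carrier Y" if "x \<in> carrier X" for x using bij_betwE [OF f] that by blast
  have "le X x y \<longleftrightarrow> le Y (f x) (f y)" if xy: "x \<in> carrier X" "y \<in> carrier X" for x y
  proof -
    interpret X: lattice X by fact
    have J: "x \<squnion>\<^bsub>X\<^esub> y \<in> carrier X" using xy by (rule X.join_closed)
    \<comment> \<open>The order is recovered from the join: x is below y exactly when their join is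
      y.\<close>
    have "x \<squnion>\<^bsub>X\<^esub> y = y \<longleftrightarrow> f (x \<squnion>\<^bsub>X\<^esub> y) = f y"
      using inj_on_eq_iff [OF bij_betw_imp_inj_on [OF f] J xy(2)] by simp
    then show ?thesis
      using lattice.le_iff_meet [OF X xy] lattice.le_iff_meet [OF Y mem mem] xy h by simp
  qed
  then show ?thesis using f by blast
qed

text \<open>An order isomorphism carries least upper and greatest lower bounds along, so
  \<open>Y\<close> inherits the lattice structure from \<open>X\<close>.\<close>

lemma lattice_isomorphic_if_order:
  assumes X: "lattice X" and Y: "partial_order Y"
    and f: "bij_betw f (carrier X) (carrier Y)"
    and le: "\<And>x y. x \<in> carrier X \<Longrightarrow> y \<in> carrier X \<Longrightarrow> le X x y \<longleftrightarrow> le Y (f x) (f y)"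
  shows "lattice_isomorphic X Y"
proof -
  interpret X: lattice X by fact
  interpret Y: partial_order Y by fact
  have mem: "f x \<in> carrier Y" if "x \<in> carrier X" for x using bij_betwE [OF f] that by blast
  have onto: "\<exists>x\<in>carrier X. y = f x" if "y \<in> carrier Y" for y
    using bij_betw_imp_surj_on [OF f] that by blast
  have least: "least Y (f s) (Upper Y {f x, f y})"
    if s: "least X s (Upper X {x, y})" and xy: "x \<in> carrier X" "y \<in> carrier X" for s x y
  proof -
    have sX: "s \<in> carrier X" using s by (rule least_closed)
    have s1: "le X x s" "le X y s" using s xy by (auto simp: least_def Upper_def)
    have "le Y (f s) u" if u: "u \<in> Upper Y {f x, f y}" for u
    proof -
      have "u \<in> carrier Y" using u by (simp add: Upper_def)
      then obtain w where w: "w \<in> carrier X" "u = f w" using onto by blast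
      have "w \<in> Upper X {x, y}"
        using u xy mem w le [of _ w] le [of w] by (auto simp: Upper_def)
      then have "le X s w" using s by (simp add: least_def)
      then show ?thesis using le sX w by simp
    qed
    moreover have "f s \<in> Upper Y {f x, f y}"
      using s1 sX xy mem le by (auto simp: Upper_def)
    moreover have "Upper Y {f x, f y} \<subseteq> carrier Y" by (auto simp: Upper_def)
    ultimately show ?thesis by (simp add: least_def)
  qed
  have greatest: "greatest Y (f s) (Lower Y {f x, f y})"
    if s: "greatest X s (Lower X {x, y})" and xy: "x \<in> carrier X" "y \<in> carrier X" for s x y
  proof -
    have sX: "s \<in> carrier X" using s by (rule greatest_closed)
    have s1: "le X s x" "le X s y" using s xy by (auto simp: greatest_def Lower_def)
    have "le Y u (f s)" if u: "u \<in> Lower Y {f x, f y}" for u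
    proof -
      have "u \<in> carrier Y" using u by (simp add: Lower_def)
      then obtain w where w: "w \<in> carrier X" "u = f w" using onto by blast
      have "w \<in> Lower X {x, y}"
        using u xy mem w le [of _ w] le [of w] by (auto simp: Lower_def)
      then have "le X w s" using s by (simp add: greatest_def)
      then show ?thesis using le sX w by simp
    qed
    moreover have "f s \<in> Lower Y {f x, f y}"
      using s1 sX xy mem le by (auto simp: Lower_def)
    moreover have "Lower Y {f x, f y} \<subseteq> carrier Y" by (auto simp: Lower_def)
    ultimately show ?thesis by (simp add: greatest_def)
  qed
  have "lattice Y"
  proof (intro lattice.intro upper_semilattice.intro lower_semilattice.intro
      upper_semilattice_axioms.intro lower_semilattice_axioms.intro Y)
    fix u v assume "u \<in> carrier Y" "v \<in> carrier Y"
    then obtain x y where xy: "x \<in> carrier X" "y \<in> carrier X" "u = f x" "v = f y"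
      using onto by blast
    show "\<exists>s. least Y s (Upper Y {u, v})"
      using X.sup_of_two_exists [OF xy(1,2)] least xy by blast
    show "\<exists>s. greatest Y s (Lower Y {u, v})"
      using X.inf_of_two_exists [OF xy(1,2)] greatest xy by blast
  qed
  then interpret Y: lattice Y .
  have "f (x \<squnion>\<^bsub>X\<^esub> y) = f x \<squnion>\<^bsub>Y\<^esub> f y" if xy: "x \<in> carrier X" "y \<in> carrier X" for x y
    using least [OF X.sup_of_two_least [OF xy] xy] Y.sup_of_two_least [OF mem mem, OF xy]
      Y.least_unique unfolding join_def by blast
  moreover have "f (x \<sqinter>\<^bsub>X\<^esub> y) = f x \<sqinter>\<^bsub>Y\<^esub> f y" if xy: "x \<in> carrier X" "y \<in> carrier X" for x y
    using greatest [OF X.inf_of_two_greatest [OF xy] xy] Y.inf_of_two_greatest [OF mem mem, OF xy]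
      Y.greatest_unique unfolding meet_def by blast
  ultimately show ?thesis
    unfolding lattice_isomorphic_def join_pres_def meet_pres_def
    using f X \<open>lattice Y\<close> by blast
qed

lemma prime_inverse_mod:
  assumes "prime p" "\<not> p dvd k"
  shows "\<exists>u v::nat. k * u = p * v + 1"
proof -
  have "k \<noteq> 0" using assms(2) by (metis dvd_0_right)
  moreover have "gcd k p = 1"
    using assms by (metis coprime_iff_gcd_eq_1 gcd.commute prime_imp_coprime_nat)
  ultimately show ?thesis using bezout_nat [of k p] by metis
qed

section \<open>Points and lines of an elementary abelian group\<close>

locale elementary_abelian_group = comm_group +
  fixes p :: nat
  assumes p: "prime p" and pow_p: "x \<in> carrier G \<Longrightarrow> x [^] p = \<one>"
    and fin: "finite (carrier G)"
begin

definition cyc :: "'a \<Rightarrow> 'a set"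
  where "cyc x = generate G {x}"

lemma cyc_eq: "x \<in> carrier G \<Longrightarrow> cyc x = {x [^] (k::nat) | k. True}"
  unfolding cyc_def using generate_pow_on_finite_carrier [OF fin] by simp

lemma cyc_subgroup: "x \<in> carrier G \<Longrightarrow> subgroup (cyc x) G"
  unfolding cyc_def by (rule generate_is_subgroup) simp

lemma mem_cyc: "x \<in> carrier G \<Longrightarrow> x \<in> cyc x"
  unfolding cyc_def by (rule generate.incl) simp

lemma cyc_least: "subgroup U G \<Longrightarrow> x \<in> U \<Longrightarrow> cyc x \<subseteq> U"
  unfolding cyc_def by (rule generate_subgroup_incl) simp_all

lemma pow_mod_p: "x \<in> carrier G \<Longrightarrow> x [^] (k::nat) = x [^] (k mod p)"
proof -
  assume x: "x \<in> carrier G"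
  have "x [^] (p * (k div p) + k mod p) = x [^] (k mod p)"
    using x by (simp only: nat_pow_mult [symmetric] nat_pow_pow [symmetric] pow_p nat_pow_one l_one nat_pow_closed)
  then show ?thesis by simp
qed

lemma mem_cyc_pow:
  assumes x: "x \<in> carrier G" and k: "\<not> p dvd k"
  shows "x \<in> cyc (x [^] (k::nat))"
proof -
  obtain u v where uv: "k * u = p * v + 1" using prime_inverse_mod [OF p k] by blast
  have "(x [^] k) [^] u = x [^] (p * v + 1)" using x uv by (simp add: nat_pow_pow)
  also have "\<dots> = x" using x by (simp add: nat_pow_pow [symmetric] pow_p)
  finally have "x = (x [^] k) [^] u" ..
  then show ?thesis using x by (auto simp: cyc_eq)
qed

text \<open>A nontrivial power of x has an exponent prime to p, so x is in turn a power of
  it.\<close>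

lemma cyc_eqI:
  assumes x: "x \<in> carrier G" and y: "y \<in> cyc x" "y \<noteq> \<one>"
  shows "cyc y = cyc x"
proof -
  obtain k :: nat where k: "y = x [^] k" using x y by (auto simp: cyc_eq)
  have "\<not> p dvd k"
  proof
    assume "p dvd k"
    then have "y = \<one>" using pow_mod_p [OF x, of k] k by (simp add: mod_eq_0_iff_dvd)
    then show False using y by simp
  qed
  then have "x \<in> cyc y" using mem_cyc_pow [OF x] k by simp
  moreover have "y \<in> carrier G" using k x by simp
  ultimately show ?thesis using cyc_least cyc_subgroup x y by (simp add: subset_antisym)
qed

text \<open>The atoms of the subgroup lattice; by \<open>minimal_cyc\<close> and
  \<open>minimalE\<close> they are the cyclic subgroups generated by nontrivial elements.\<close>

definition minimal :: "'a set \<Rightarrow> bool"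
  where "minimal U \<longleftrightarrow> subgroup U G \<and> U \<noteq> {\<one>} \<and> (\<forall>V. subgroup V G \<longrightarrow> V \<subseteq> U \<longrightarrow> V = {\<one>} \<or> V = U)"

lemma subgroup_nontrivial: "subgroup U G \<Longrightarrow> U \<noteq> {\<one>} \<Longrightarrow> \<exists>x\<in>U. x \<noteq> \<one>"
  using subgroup.one_closed by fastforce

lemma minimal_cyc:
  assumes x: "x \<in> carrier G" "x \<noteq> \<one>"
  shows "minimal (cyc x)"
proof -
  have "V = {\<one>} \<or> V = cyc x" if V: "subgroup V G" "V \<subseteq> cyc x" for V
  proof (rule disjCI)
    assume "V \<noteq> cyc x"
    show "V = {\<one>}"
    proof (rule ccontr)
      assume "V \<noteq> {\<one>}"
      then obtain y where y: "y \<in> V" "y \<noteq> \<one>" using subgroup_nontrivial V by blast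
      then have "cyc y = cyc x" using cyc_eqI x V by blast
      then have "cyc x \<subseteq> V" using cyc_least [OF V(1) y(1)] by simp
      then show False using V \<open>V \<noteq> cyc x\<close> by blast
    qed
  qed
  then show ?thesis unfolding minimal_def using cyc_subgroup mem_cyc x by blast
qed

lemma minimalE:
  assumes "minimal U"
  obtains x where "x \<in> carrier G" "x \<noteq> \<one>" "x \<in> U" "U = cyc x"
proof -
  have U: "subgroup U G" using assms by (simp add: minimal_def)
  obtain x where x: "x \<in> U" "x \<noteq> \<one>" using assms subgroup_nontrivial by (auto simp: minimal_def)
  have xG: "x \<in> carrier G" using U x(1) by (rule subgroup.mem_carrier)
  have "cyc x \<noteq> {\<one>}" using mem_cyc [OF xG] x by blast
  then have "U = cyc x"
    using assms cyc_subgroup [OF xG] cyc_least [OF U x(1)] by (auto simp: minimal_def)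
  then show thesis using that x xG by blast
qed

text \<open>With \<open>V\<close> as the point at infinity, each other point of the line is
  generated by u v^j for a unique j below p.\<close>

lemma card_minimal_line:
  assumes U: "minimal U" and V: "minimal V" and UV: "U \<noteq> V"
  shows "card {W. minimal W \<and> W \<subseteq> U <#> V \<and> W \<noteq> V} = p"
proof -
  obtain u where u: "u \<in> carrier G" "u \<noteq> \<one>" "u \<in> U" "U = cyc u" using U by (rule minimalE)
  obtain v where v: "v \<in> carrier G" "v \<noteq> \<one>" "v \<in> V" "V = cyc v" using V by (rule minimalE)
  have sU: "subgroup U G" and sV: "subgroup V G" using U V by (auto simp: minimal_def)
  have uV: "u \<notin> V" using cyc_eqI [OF v(1)] u(2,4) v(4) UV by blast
  have vj: "v [^] (j::nat) \<in> V" for j using pow_closed_subgroup [OF sV v(3)] .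
  have nV: "u \<otimes> v [^] (j::nat) \<notin> V" for j
  proof
    assume "u \<otimes> v [^] j \<in> V"
    then have "(u \<otimes> v [^] j) \<otimes> inv (v [^] j) \<in> V"
      using vj by (rule subgroup.m_closed [OF sV _ subgroup.m_inv_closed [OF sV]])
    then show False using uV u v by (simp add: m_assoc)
  qed
  define c where "c j = cyc (u \<otimes> v [^] (j::nat))" for j
  define X where "X = {W. minimal W \<and> W \<subseteq> U <#> V \<and> W \<noteq> V}"
  have G: "u \<otimes> v [^] (j::nat) \<in> carrier G" for j using u v by simp
  have n1: "u \<otimes> v [^] (j::nat) \<noteq> \<one>" for j using nV [of j] subgroup.one_closed [OF sV] by auto
  have sUV: "subgroup (U <#> V) G" using mult_subgroups [OF sU sV] .
  have memc: "u \<otimes> v [^] j \<in> c j" for j unfolding c_def using G by (rule mem_cyc)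
  have cX: "c j \<in> X" for j
  proof -
    have "c j \<subseteq> U <#> V"
      unfolding c_def using sUV by (rule cyc_least) (use u(3) vj in \<open>auto simp: mem_set_mult\<close>)
    moreover have "c j \<noteq> V" using memc nV by blast
    moreover have "minimal (c j)" unfolding c_def using G n1 by (rule minimal_cyc)
    ultimately show ?thesis by (simp add: X_def)
  qed
  have wlog: "i = j" if ij: "i \<le> j" "j < p" "c i = c j" for i j
  proof (rule ccontr)
    assume "i \<noteq> j"
    then have d: "\<not> p dvd (j - i)" using ij by (auto dest: dvd_imp_le)
    have sc: "subgroup (c j) G" using cX by (simp add: X_def minimal_def)
    \<comment> \<open>The quotient of the two generators is v^(j - i). As j - i is prime to p, it
      generates \<open>V\<close>, which would then lie in \<open>c j\<close>.\<close>
    have "inv (u \<otimes> v [^] i) \<otimes> (u \<otimes> v [^] j) \<in> c j"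
      using memc [of i] memc [of j] ij(3)
      by (simp add: subgroup.m_closed [OF sc] subgroup.m_inv_closed [OF sc])
    moreover have "v [^] j = v [^] i \<otimes> v [^] (j - i)" using v(1) ij(1) by (simp add: nat_pow_mult)
    ultimately have "v [^] (j - i) \<in> c j" using u v by (simp add: inv_mult_group m_assoc)
    then have "v \<in> c j" using mem_cyc_pow [OF v(1) d] cyc_least [OF sc] by blast
    then have "V \<subseteq> c j" using cyc_least [OF sc] v(4) by simp
    then have "V = c j" using cX [of j] sV V by (auto simp: X_def minimal_def)
    then show False using cX [of j] by (simp add: X_def)
  qed
  have "bij_betw c {..<p} X"
    unfolding bij_betw_def
  proof
    show "inj_on c {..<p}"
      by (rule inj_onI) (metis wlog lessThan_iff nat_le_linear)
    show "c ` {..<p} = X"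
    proof (intro subset_antisym subsetI)
      fix W assume "W \<in> X"
      then have W: "minimal W" "W \<subseteq> U <#> V" "W \<noteq> V" by (auto simp: X_def)
      obtain w where w: "w \<in> carrier G" "w \<noteq> \<one>" "w \<in> W" "W = cyc w" using W(1) by (rule minimalE)
      have sW: "subgroup W G" using W(1) by (simp add: minimal_def)
      have "w \<in> U <#> V" using W(2) w(3) ..
      then obtain a b :: nat where ab: "w = u [^] a \<otimes> v [^] b"
        using u(1,4) v(1,4) by (auto simp: mem_set_mult cyc_eq)
      have a: "\<not> p dvd a"
      proof
        assume "p dvd a"
        then have "w = v [^] b" using ab pow_mod_p [OF u(1), of a] u v by (simp add: mod_eq_0_iff_dvd)
        then have "w \<in> V" using vj by simp
        then have "cyc w = V" using cyc_eqI [OF v(1), of w] w(2) v(4) by simp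
        then show False using W(3) w(4) by simp
      qed
      \<comment> \<open>Since r inverts a modulo p, raising w to the power r normalizes the exponent
        of u to 1.\<close>
      obtain r s where rs: "a * r = p * s + 1" using prime_inverse_mod [OF p a] by blast
      have "w [^] r = (u [^] a) [^] r \<otimes> (v [^] b) [^] r"
        unfolding ab using u v by (simp add: nat_pow_distrib)
      also have "\<dots> = u [^] (p * s + 1) \<otimes> v [^] (b * r)" using u v rs by (simp add: nat_pow_pow)
      also have "\<dots> = u \<otimes> v [^] (b * r mod p)"
        using u pow_mod_p [OF v(1), of "b * r"] by (simp add: nat_pow_pow [symmetric] pow_p)
      finally have wr: "w [^] r = u \<otimes> v [^] (b * r mod p)" .
      have "w [^] r \<in> cyc w" using pow_closed_subgroup [OF sW w(3)] w(4) by simp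
      then have "cyc (w [^] r) = cyc w" using cyc_eqI [OF w(1)] n1 wr by simp
      then have "W = c (b * r mod p)" using wr w(4) by (simp add: c_def)
      then show "W \<in> c ` {..<p}" using prime_gt_0_nat [OF p] by simp
    qed (use cX in auto)
  qed
  then have "card X = p" by (metis bij_betw_same_card card_lessThan)
  then show ?thesis by (simp add: X_def)
qed

text \<open>A minimal subgroup has at most p elements, which is fewer than p^n because n is at least
  2.\<close>

lemma other_minimal:
  assumes U: "minimal U" and n: "order G = p ^ n" "n \<ge> 2"
  shows "\<exists>V. minimal V \<and> V \<noteq> U"
proof -
  obtain u where u: "u \<in> carrier G" "U = cyc u" using U by (rule minimalE)
  have "U \<subseteq> (\<lambda>k. u [^] k) ` {..<p}"
  proof
    fix x assume "x \<in> U"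
    then obtain k :: nat where "x = u [^] k" using u by (auto simp: cyc_eq)
    then have "x = u [^] (k mod p)" using pow_mod_p [OF u(1)] by simp
    then show "x \<in> (\<lambda>k. u [^] k) ` {..<p}" using prime_gt_0_nat [OF p] by simp
  qed
  then have "card U \<le> card ((\<lambda>k. u [^] k) ` {..<p})" by (intro card_mono) simp_all
  also have "\<dots> \<le> p" using card_image_le [of "{..<p}" "\<lambda>k. u [^] k"] by simp
  also have "p < p ^ n" using n(2) prime_gt_1_nat [OF p] power_strict_increasing [of 1 n p] by simp
  finally have "card U < card (carrier G)" using n by (simp add: order_def)
  then have "U \<noteq> carrier G" by auto
  then obtain x where x: "x \<in> carrier G" "x \<notin> U"
    using U subgroup.subset by (auto simp: minimal_def)
  then have "x \<noteq> \<one>" using U subgroup.one_closed by (auto simp: minimal_def)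
  then show ?thesis using minimal_cyc mem_cyc x by blast
qed

end

section \<open>Transfer of the geometry to the Chermak-Delgado lattice\<close>

lemma cd_projectiveI:
  fixes G :: "('a, 'm) monoid_scheme" (structure) and E :: "('b, 'k) monoid_scheme"
  assumes "group G" "finite (carrier G)" "carrier G \<in> CD G" "prime p" "n \<ge> 2"
    and E: "elementary_abelian p E" "order E = p ^ n"
    and iso: "lattice_isomorphic (CD_lattice G) (subgroup_lattice E)"
  shows "cd_projective G p"
proof -
  interpret cd_group G
    using assms by (simp add: cd_group_def finite_group_def finite_group_axioms_def cd_group_axioms_def)
  have "finite (carrier E)"
    using E(2) prime_gt_0_nat [OF assms(4)] unfolding order_def by (metis card_gt_0_iff zero_less_power)
  then interpret E: elementary_abelian_group E p
    using E(1) assms(4) unfolding elementary_abelian_def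
    by (intro elementary_abelian_group.intro elementary_abelian_group_axioms.intro) auto
  obtain f where f: "bij_betw f (CD G) {U. subgroup U E}"
    and le: "\<And>H K. H \<in> CD G \<Longrightarrow> K \<in> CD G \<Longrightarrow> H \<subseteq> K \<longleftrightarrow> f H \<subseteq> f K"
    using lattice_isomorphic_order [OF iso] by (auto simp: CD_lattice_def subgroup_lattice_def)
  have mem: "subgroup (f H) E" if "H \<in> CD G" for H using bij_betwE [OF f] that by blast
  have onto: "\<exists>H\<in>CD G. f H = U" if "subgroup U E" for U
  proof -
    have "U \<in> f ` CD G" using bij_betw_imp_surj_on [OF f] that by simp
    then show ?thesis by auto
  qed
  have eq: "H = K \<longleftrightarrow> f H = f K" if "H \<in> CD G" "K \<in> CD G" for H K
    using inj_onD [OF bij_betw_imp_inj_on [OF f]] that by blast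
  have bot: "f (center G) = {\<one>\<^bsub>E\<^esub>}"
  proof -
    obtain H where H: "H \<in> CD G" "f H = {\<one>\<^bsub>E\<^esub>}" using onto E.triv_subgroup by blast
    then have "f (center G) \<subseteq> {\<one>\<^bsub>E\<^esub>}"
      using le [OF center_CD H(1)] center_subset_CD by simp
    then show ?thesis using subgroup.one_closed [OF mem [OF center_CD]] by blast
  qed
  have atom: "atom A \<longleftrightarrow> E.minimal (f A)" if A: "A \<in> CD G" for A
  proof
    assume at: "atom A"
    have "f A \<noteq> {\<one>\<^bsub>E\<^esub>}" using atomD(2) [OF at] eq [OF A center_CD] bot by simp
    moreover have "V = {\<one>\<^bsub>E\<^esub>} \<or> V = f A" if V: "subgroup V E" "V \<subseteq> f A" for V
    proof -
      obtain H where H: "H \<in> CD G" "f H = V" using onto V(1) by blast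
      then have "H = center G \<or> H = A" using atomD(5) [OF at H(1)] le [OF H(1) A] V(2) by simp
      then show ?thesis using H(2) bot by blast
    qed
    ultimately show "E.minimal (f A)" using mem [OF A] by (simp add: E.minimal_def)
  next
    assume m: "E.minimal (f A)"
    have "A \<noteq> center G" using m bot by (auto simp: E.minimal_def)
    moreover have "H = center G \<or> H = A" if H: "H \<in> CD G" "H \<subseteq> A" for H
    proof -
      have "f H \<subseteq> f A" using le [OF H(1) A] H(2) by simp
      then have "f H = {\<one>\<^bsub>E\<^esub>} \<or> f H = f A" using m mem [OF H(1)] by (simp add: E.minimal_def)
      then show ?thesis using eq [OF H(1) A] eq [OF H(1) center_CD] bot by simp
    qed
    ultimately show "atom A" using A by (simp add: atom_def)
  qed
  have minimal_atom: "\<exists>A. atom A \<and> f A = U" if U: "E.minimal U" for U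
  proof -
    have "subgroup U E" using U by (simp add: E.minimal_def)
    then obtain H where "H \<in> CD G" "f H = U" using onto by blast
    then show ?thesis using U atom by blast
  qed
  \<comment> \<open>Both products are least upper bounds, in \<open>CD G\<close> by
    \<open>CD_Int_set_mult\<close> and in \<open>E\<close> by commutativity, and an order
    isomorphism respects these.\<close>
  have join: "f (A <#> B) = f A <#>\<^bsub>E\<^esub> f B" if AB: "A \<in> CD G" "B \<in> CD G" for A B
  proof
    note J = CD_Int_set_mult(2) [OF AB]
    note sub = subset_set_mult [OF CD_subgroup [OF AB(1)] CD_subgroup [OF AB(2)]]
    show "f A <#>\<^bsub>E\<^esub> f B \<subseteq> f (A <#> B)"
      using E.set_mult_least [OF mem [OF J]] le [OF AB(1) J] le [OF AB(2) J] sub by simp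
    have sE: "subgroup (f A <#>\<^bsub>E\<^esub> f B) E" using E.mult_subgroups mem AB by blast
    then obtain K where K: "K \<in> CD G" "f K = f A <#>\<^bsub>E\<^esub> f B" using onto by blast
    have "A \<subseteq> K" "B \<subseteq> K"
      using le [OF AB(1) K(1)] le [OF AB(2) K(1)] K(2) E.subset_set_mult [OF mem [OF AB(1)] mem [OF AB(2)]]
      by simp_all
    then have "A <#> B \<subseteq> K" by (rule set_mult_least [OF CD_subgroup [OF K(1)]])
    then show "f (A <#> B) \<subseteq> f A <#>\<^bsub>E\<^esub> f B" using le [OF J K(1)] K(2) by simp
  qed
  show ?thesis
  proof (rule cd_projective.intro [OF cd_group_axioms cd_projective_axioms.intro])
    show "prime p" by fact
  next
    fix H K assume H: "H \<in> CD G" and K: "K \<in> CD G" and HK: "\<not> H \<subseteq> K"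
    \<comment> \<open>The cyclic group generated by such an x is the image of the separating
      atom.\<close>
    then obtain x where x: "x \<in> f H" "x \<notin> f K" using le by blast
    have xE: "x \<in> carrier E" using mem [OF H] x(1) by (rule subgroup.mem_carrier)
    have "x \<noteq> \<one>\<^bsub>E\<^esub>" using x(2) subgroup.one_closed [OF mem [OF K]] by blast
    then obtain A where A: "atom A" "f A = E.cyc x"
      using minimal_atom E.minimal_cyc xE by blast
    have "A \<subseteq> H" using le [OF atomD(1) [OF A(1)] H] A(2) E.cyc_least [OF mem [OF H] x(1)] by simp
    moreover have "\<not> A \<subseteq> K"
      using le [OF atomD(1) [OF A(1)] K] A(2) E.mem_cyc [OF xE] x(2) by blast
    ultimately show "\<exists>A. atom A \<and> A \<subseteq> H \<and> \<not> A \<subseteq> K" using A(1) by blast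
  next
    fix A B assume A: "atom A" and B: "atom B" and AB: "A \<noteq> B"
    note cd = atomD(1) [OF A] atomD(1) [OF B]
    define X where "X = {C. atom C \<and> C \<subseteq> A <#> B \<and> C \<noteq> B}"
    have sub: "X \<subseteq> CD G" using atomD(1) by (auto simp: X_def)
    have "f ` X = {W. E.minimal W \<and> W \<subseteq> f A <#>\<^bsub>E\<^esub> f B \<and> W \<noteq> f B}"
    proof (intro subset_antisym subsetI)
      fix W assume "W \<in> f ` X"
      then obtain C where C: "W = f C" "atom C" "C \<subseteq> A <#> B" "C \<noteq> B" by (auto simp: X_def)
      note cC = atomD(1) [OF C(2)]
      show "W \<in> {W. E.minimal W \<and> W \<subseteq> f A <#>\<^bsub>E\<^esub> f B \<and> W \<noteq> f B}"
        using C atom [OF cC] le [OF cC CD_Int_set_mult(2) [OF cd]] eq [OF cC cd(2)] join [OF cd] by simp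
    next
      fix W assume "W \<in> {W. E.minimal W \<and> W \<subseteq> f A <#>\<^bsub>E\<^esub> f B \<and> W \<noteq> f B}"
      then have W: "E.minimal W" "W \<subseteq> f A <#>\<^bsub>E\<^esub> f B" "W \<noteq> f B" by auto
      obtain C where C: "atom C" "f C = W" using minimal_atom W(1) by blast
      have "C \<subseteq> A <#> B"
        using le [OF atomD(1) [OF C(1)] CD_Int_set_mult(2) [OF cd]] W(2) C(2) join [OF cd] by simp
      then have "C \<in> X" using C W(3) by (auto simp: X_def)
      then show "W \<in> f ` X" using C(2) by blast
    qed
    moreover have "card (f ` X) = card X"
      using bij_betw_imp_inj_on [OF f] sub by (meson card_image inj_on_subset)
    moreover have "card {W. E.minimal W \<and> W \<subseteq> f A <#>\<^bsub>E\<^esub> f B \<and> W \<noteq> f B} = p"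
      using A B AB atom [OF cd(1)] atom [OF cd(2)] eq [OF cd] by (intro E.card_minimal_line) simp_all
    ultimately show "card {C. atom C \<and> C \<subseteq> A <#> B \<and> C \<noteq> B} = p" by (simp add: X_def)
  next
    fix A assume A: "atom A"
    then have "E.minimal (f A)" using atom atomD(1) by blast
    then obtain V where V: "E.minimal V" "V \<noteq> f A" using E.other_minimal E(2) assms(5) by blast
    then show "\<exists>B. atom B \<and> B \<noteq> A" using minimal_atom by blast
  qed
qed

section \<open>Direct decomposition\<close>

lemma coprime_factorization_unique:
  fixes a b k m :: nat
  assumes "a * b = k * m" "coprime b k" "coprime a m"
  shows "a = k" "b = m"
proof -
  have "a dvd k" using assms(1,3) by (metis coprime_dvd_mult_left_iff dvd_triv_left)
  moreover have "k dvd a" using assms(1,2) by (metis coprime_commute coprime_dvd_mult_left_iff dvd_triv_left)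
  ultimately show "a = k" by (rule dvd_antisym)
  have "b dvd m" using assms(1,2) by (metis coprime_dvd_mult_right_iff dvd_triv_right)
  moreover have "m dvd b" using assms(1,3) by (metis coprime_commute coprime_dvd_mult_right_iff dvd_triv_right)
  ultimately show "b = m" by (rule dvd_antisym)
qed

lemma coprime_if_primes:
  fixes a b :: nat
  assumes "\<And>r. prime r \<Longrightarrow> r dvd a \<Longrightarrow> r dvd b \<Longrightarrow> False"
  shows "coprime a b"
proof (rule ccontr)
  assume "\<not> coprime a b"
  then have "gcd a b \<noteq> 1" by (simp add: coprime_iff_gcd_eq_1)
  then obtain r where "prime r" "r dvd gcd a b" using prime_factor_nat by blast
  then show False using assms [of r] by simp
qed

context finite_group
begin

text \<open>Cauchy's theorem in disguise: \<open>sylow_thm\<close> with exponent 1 yields a subgroup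
  of order r, even if r divides the cofactor, and its nontrivial elements have order r.\<close>

lemma prime_dvd_order_dvd_exponent:
  assumes r: "prime r" "r dvd order G" and k: "\<And>x. x \<in> carrier G \<Longrightarrow> x [^] (k::nat) = \<one>"
  shows "r dvd k"
proof -
  obtain m where "order G = r ^ 1 * m" using r(2) by (auto elim: dvdE)
  then obtain H where H: "subgroup H G" "card H = r"
    using sylow_thm [OF r(1) is_group _ fin, of 1 m] by auto
  have "card H > card {\<one>}" using H(2) prime_gt_1_nat [OF r(1)] by simp
  then have "\<not> H \<subseteq> {\<one>}" using card_mono [of "{\<one>}" H] by fastforce
  then obtain x where x: "x \<in> H" "x \<noteq> \<one>" by blast
  have xG: "x \<in> carrier G" using H(1) x(1) by (rule subgroup.mem_carrier)
  interpret H: group "G\<lparr>carrier := H\<rparr>" using H(1) by (rule subgroup_imp_group)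
  have "x [^]\<^bsub>G\<lparr>carrier := H\<rparr>\<^esub> order (G\<lparr>carrier := H\<rparr>) = \<one>"
    using H.pow_order_eq_1 [of x] x by simp
  then have "x [^] r = \<one>" using H(2) by (simp add: order_def nat_pow_consistent [symmetric])
  then have "ord x dvd r" using xG by (simp add: pow_eq_id)
  moreover have "ord x \<noteq> 1" using ord_eq_1 [OF xG] x(2) by blast
  ultimately have "ord x = r" using r(1) by (metis prime_nat_iff)
  then show ?thesis using k [OF xG] xG by (simp add: pow_eq_id)
qed

text \<open>The hypotheses avoid \<open>commutator\<close>, so that for the group with carrier
  \<open>P\<close> they can be checked by computing in \<open>G\<close>.\<close>

lemma elementary_abelian_Mod_center:
  assumes comm: "\<And>x y. x \<in> carrier G \<Longrightarrow> y \<in> carrier G \<Longrightarrow> \<exists>z\<in>center G. x \<otimes> y = z \<otimes> (y \<otimes> x)"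
    and pow: "\<And>x. x \<in> carrier G \<Longrightarrow> x [^] p \<in> center G"
  shows "elementary_abelian p (G Mod center G)"
proof -
  have "center G \<lhd> G"
    using center_subgroup
  proof (rule normal_invI)
    fix x h assume x: "x \<in> carrier G" and h: "h \<in> center G"
    have "x \<otimes> h \<otimes> inv x = h \<otimes> x \<otimes> inv x" using center_commutes [OF h x] by simp
    also have "\<dots> = h" using x h by (simp add: m_assoc center_carrier)
    finally show "x \<otimes> h \<otimes> inv x \<in> center G" using h by simp
  qed
  then interpret N: normal "center G" G .
  interpret F: group "G Mod center G" by (rule N.factorgroup_is_group)
  show ?thesis
    unfolding elementary_abelian_def
  proof (intro conjI ballI F.group_comm_groupI)
    fix X Y assume "X \<in> carrier (G Mod center G)" "Y \<in> carrier (G Mod center G)"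
    then obtain x y where x: "x \<in> carrier G" "X = center G #> x" and y: "y \<in> carrier G" "Y = center G #> y"
      by (auto simp: carrier_FactGroup)
    obtain z where z: "z \<in> center G" "x \<otimes> y = z \<otimes> (y \<otimes> x)" using comm x(1) y(1) by blast
    have "center G #> (z \<otimes> (y \<otimes> x)) = (center G #> z) #> (y \<otimes> x)"
      using x(1) y(1) z(1) N.subset by (simp add: coset_mult_assoc center_carrier)
    also have "center G #> z = center G"
      using center_subgroup z(1) by (simp add: coset_join2 center_carrier)
    finally have "center G #> (x \<otimes> y) = center G #> (y \<otimes> x)" using z(2) by simp
    then show "X \<otimes>\<^bsub>G Mod center G\<^esub> Y = Y \<otimes>\<^bsub>G Mod center G\<^esub> X"
      using x y by (simp add: N.rcos_sum)
  next
    fix X assume "X \<in> carrier (G Mod center G)"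
    then obtain x where x: "x \<in> carrier G" "X = center G #> x"
      by (auto simp: carrier_FactGroup)
    have "center G #> x [^] p = center G"
      using center_subgroup pow [OF x(1)] by (simp add: coset_join2 center_carrier)
    then show "X [^]\<^bsub>G Mod center G\<^esub> p = \<one>\<^bsub>G Mod center G\<^esub>"
      using x N.FactGroup_pow by simp
  qed
qed

end

section \<open>Central direct factors and the Chermak-Delgado lattice\<close>

locale central_product = finite_group +
  fixes P Q
  assumes sP: "subgroup P G" and sQ: "subgroup Q G" and QZ: "Q \<subseteq> center G"
    and PQ: "P <#> Q = carrier G" and Int: "P \<inter> Q = {\<one>}"
begin

lemma finite_group_P: "finite_group (G\<lparr>carrier := P\<rparr>)"
  using subgroup_imp_group [OF sP] sP by (simp add: finite_group_def finite_group_axioms_def)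

lemma subgroup_P_iff: "subgroup K (G\<lparr>carrier := P\<rparr>) \<longleftrightarrow> subgroup K G \<and> K \<subseteq> P"
  using incl_subgroup [OF sP] subgroup_incl [OF _ sP] subgroup.subset [of K "G\<lparr>carrier := P\<rparr>"] by auto

lemma Q_commutes: "q \<in> Q \<Longrightarrow> x \<in> carrier G \<Longrightarrow> q \<otimes> x = x \<otimes> q"
  using QZ center_commutes by blast

lemma internal_direct_product: "internal_direct_product G P Q"
proof -
  note PG = subgroup.mem_carrier [OF sP] and QG = subgroup.mem_carrier [OF sQ]
  have "inj_on (\<lambda>(a, b). a \<otimes> b) (P \<times> Q)"
  proof (rule inj_onI, clarsimp)
    fix a b c d assume *: "a \<in> P" "b \<in> Q" "c \<in> P" "d \<in> Q" "a \<otimes> b = c \<otimes> d"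
    note [simp] = PG [OF *(1)] QG [OF *(2)] PG [OF *(3)] QG [OF *(4)]
    have "inv c \<otimes> a = inv c \<otimes> (a \<otimes> b) \<otimes> inv b" by (simp add: m_assoc)
    also have "\<dots> = d \<otimes> inv b" unfolding *(5) by simp
    finally have e: "inv c \<otimes> a = d \<otimes> inv b" .
    moreover have "inv c \<otimes> a \<in> P" "d \<otimes> inv b \<in> Q"
      using * by (simp_all add: subgroup.m_closed [OF sP] subgroup.m_inv_closed [OF sP]
          subgroup.m_closed [OF sQ] subgroup.m_inv_closed [OF sQ])
    ultimately have 1: "inv c \<otimes> a = \<one>" using Int by auto
    have "a = c \<otimes> (inv c \<otimes> a)" by simp
    then have "a = c" unfolding 1 by simp
    then show "a = c \<and> b = d" using *(5) by simp
  qed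
  moreover have "(\<lambda>(a, b). a \<otimes> b) ` (P \<times> Q) = carrier G"
    unfolding PQ [symmetric] by (auto simp: set_mult_def)
  moreover have "(a \<otimes> c) \<otimes> (b \<otimes> d) = (a \<otimes> b) \<otimes> (c \<otimes> d)"
    if "a \<in> P" "b \<in> Q" "c \<in> P" "d \<in> Q" for a b c d
  proof -
    note [simp] = PG [OF that(1)] QG [OF that(2)] PG [OF that(3)] QG [OF that(4)]
    have "(a \<otimes> c) \<otimes> (b \<otimes> d) = a \<otimes> (c \<otimes> b) \<otimes> d" by (simp add: m_assoc)
    also have "c \<otimes> b = b \<otimes> c" using Q_commutes [OF that(2), of c] by simp
    finally show ?thesis by (simp add: m_assoc)
  qed
  ultimately show ?thesis
    unfolding internal_direct_product_def iso_def bij_betw_def hom_def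
    using sP sQ PG QG by (auto simp: DirProd_def)
qed

text \<open>Dedekind's modular law: if h = a b with b in \<open>Q\<close>, then b is in
  \<open>H\<close> already, and hence so is a.\<close>

lemma decompose:
  assumes "subgroup H G" "Q \<subseteq> H"
  shows "(H \<inter> P) <#> Q = H" "subgroup (H \<inter> P) G" "card H = card (H \<inter> P) * card Q"
proof -
  show s: "subgroup (H \<inter> P) G" using assms(1) sP by (rule subgroups_Inter_pair)
  show e: "(H \<inter> P) <#> Q = H"
  proof
    show "(H \<inter> P) <#> Q \<subseteq> H" using assms by (intro set_mult_least) auto
    show "H \<subseteq> (H \<inter> P) <#> Q"
    proof
      fix h assume h: "h \<in> H"
      then have "h \<in> P <#> Q" using PQ subgroup.mem_carrier [OF assms(1)] by blast
      then obtain a b where ab: "h = a \<otimes> b" "a \<in> P" "b \<in> Q" by (auto simp: mem_set_mult)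
      have "a = h \<otimes> inv b"
        using ab subgroup.mem_carrier [OF sP] subgroup.mem_carrier [OF sQ] by (simp add: m_assoc)
      moreover have "b \<in> H" using ab(3) assms(2) by blast
      ultimately have "a \<in> H"
        using h assms(1) by (simp add: subgroup.m_closed subgroup.m_inv_closed)
      then show "h \<in> (H \<inter> P) <#> Q" using ab by (auto simp: mem_set_mult)
    qed
  qed
  have "(H \<inter> P) \<inter> Q = {\<one>}" using Int assms subgroup.one_closed by blast
  then show "card H = card (H \<inter> P) * card Q"
    using card_set_mult_Int [OF s sQ] e by simp
qed

lemma compose:
  assumes K: "subgroup K G" "K \<subseteq> P"
  shows "subgroup (K <#> Q) G" "(K <#> Q) \<inter> P = K" "Q \<subseteq> K <#> Q"
proof -
  note KG = subgroup.mem_carrier [OF K(1)] and QG = subgroup.mem_carrier [OF sQ]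
  show Q: "Q \<subseteq> K <#> Q" using subset_set_mult [OF K(1) sQ] by simp
  show "subgroup (K <#> Q) G"
  proof (rule subgroup_if_finite_closed)
    show sub: "K <#> Q \<subseteq> carrier G" using KG QG by (auto simp: mem_set_mult)
    then show "finite (K <#> Q)" by (rule finite_subset) simp
    show "K <#> Q \<noteq> {}" using Q subgroup.one_closed [OF sQ] by blast
    fix x y assume "x \<in> K <#> Q" "y \<in> K <#> Q"
    then obtain a b c d where *: "x = a \<otimes> b" "a \<in> K" "b \<in> Q" "y = c \<otimes> d" "c \<in> K" "d \<in> Q"
      by (auto simp: mem_set_mult)
    note [simp] = KG [OF *(2)] QG [OF *(3)] KG [OF *(5)] QG [OF *(6)]
    have "x \<otimes> y = a \<otimes> (b \<otimes> c) \<otimes> d" by (simp add: *(1,4) m_assoc)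
    also have "b \<otimes> c = c \<otimes> b" using Q_commutes [OF *(3)] by simp
    finally have "x \<otimes> y = (a \<otimes> c) \<otimes> (b \<otimes> d)" by (simp add: m_assoc)
    moreover have "a \<otimes> c \<in> K" using subgroup.m_closed [OF K(1) *(2,5)] .
    moreover have "b \<otimes> d \<in> Q" using subgroup.m_closed [OF sQ *(3,6)] .
    ultimately show "x \<otimes> y \<in> K <#> Q" unfolding mem_set_mult by blast
  qed
  show "(K <#> Q) \<inter> P = K"
  proof
    show "K \<subseteq> (K <#> Q) \<inter> P" using subset_set_mult [OF K(1) sQ] K(2) by simp
    show "(K <#> Q) \<inter> P \<subseteq> K"
    proof
      fix x assume x: "x \<in> (K <#> Q) \<inter> P"
      then obtain a b where ab: "x = a \<otimes> b" "a \<in> K" "b \<in> Q" by (auto simp: mem_set_mult)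
      have "b = inv a \<otimes> x" using ab KG QG by simp
      moreover have "inv a \<otimes> x \<in> P"
        using x ab K(2) by (simp add: subset_iff subgroup.m_closed [OF sP] subgroup.m_inv_closed [OF sP])
      ultimately have "b \<in> P" by simp
      then have "b = \<one>" using ab(3) Int by blast
      then show "x \<in> K" using ab KG by simp
    qed
  qed
qed

text \<open>As \<open>Q\<close> is central, \<open>H\<close> and \<open>H \<inter> P\<close> have
  the same centralizer, which again contains \<open>Q\<close>. So each of the two factors of the
  measure splits off \<open>card Q\<close>.\<close>

lemma cd_measure_decompose:
  assumes H: "subgroup H G" "Q \<subseteq> H"
  shows "cd_measure G H = cd_measure (G\<lparr>carrier := P\<rparr>) (H \<inter> P) * (card Q * card Q)"
proof -
  note s = decompose [OF H]
  have "centralizer G Q = carrier G"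
    using QZ subgroup.mem_carrier [OF sQ] Q_commutes by (auto simp: centralizer_def)
  then have "centralizer G H = centralizer G (H \<inter> P)"
    using centralizer_set_mult [OF s(2) sQ] s(1) by (auto simp: centralizer_def)
  moreover have "centralizer G (H \<inter> P) \<inter> P = centralizer (G\<lparr>carrier := P\<rparr>) (H \<inter> P)"
    using subgroup.mem_carrier [OF sP] by (auto simp: centralizer_def)
  moreover have "card (centralizer G H) = card (centralizer G H \<inter> P) * card Q"
  proof (rule decompose(3))
    show "subgroup (centralizer G H) G" using H(1) by (simp add: centralizer_subgroup subgroup.subset)
    show "Q \<subseteq> centralizer G H" using QZ center_subset_centralizer [OF subgroup.subset [OF H(1)]] by blast
  qed
  ultimately show ?thesis using s(3) by (simp add: cd_measure_def)
qed

lemma max_cd_measure_decompose: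
  "max_cd_measure G = max_cd_measure (G\<lparr>carrier := P\<rparr>) * (card Q * card Q)"
proof (rule antisym)
  interpret P: finite_group "G\<lparr>carrier := P\<rparr>" by (rule finite_group_P)
  \<comment> \<open>A subgroup of maximal measure contains the center and thus \<open>Q\<close>, so
    the maximum over \<open>G\<close> is attained at a subgroup that decomposes.\<close>
  obtain H where H: "H \<in> CD G" using CD_nonempty by blast
  have Q: "Q \<subseteq> H" using QZ center_subset_CD [OF H] by blast
  have sHP: "subgroup (H \<inter> P) (G\<lparr>carrier := P\<rparr>)"
    using decompose(2) [OF CD_subgroup [OF H] Q] by (simp add: subgroup_P_iff)
  show "max_cd_measure G \<le> max_cd_measure (G\<lparr>carrier := P\<rparr>) * (card Q * card Q)"
    using mult_le_mono1 [OF P.cd_measure_le [OF sHP], of "card Q * card Q"]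
      cd_measure_decompose [OF CD_subgroup [OF H] Q] H
    by (simp only: CD_def mem_Collect_eq)
  obtain K where K: "K \<in> CD (G\<lparr>carrier := P\<rparr>)" using P.CD_nonempty by blast
  have K': "subgroup K G" "K \<subseteq> P" using P.CD_subgroup [OF K] by (simp_all add: subgroup_P_iff)
  note c = compose [OF K']
  show "max_cd_measure (G\<lparr>carrier := P\<rparr>) * (card Q * card Q) \<le> max_cd_measure G"
    using cd_measure_le [OF c(1)] cd_measure_decompose [OF c(1,3)] c(2) K by (simp add: CD_def)
qed

lemma card_Q_pos: "card Q * card Q > 0"
  using card_subgroup_pos [OF sQ] by simp

lemma CD_decompose:
  assumes "subgroup H G" "Q \<subseteq> H"
  shows "H \<in> CD G \<longleftrightarrow> H \<inter> P \<in> CD (G\<lparr>carrier := P\<rparr>)"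
  using assms decompose(2) [OF assms] card_Q_pos
  by (simp add: CD_def cd_measure_decompose max_cd_measure_decompose subgroup_P_iff)

text \<open>The inverse of intersecting with \<open>P\<close> is multiplication by \<open>Q\<close>,
  since every member of \<open>CD G\<close> contains the center and therefore
  \<open>Q\<close>.\<close>

lemma CD_lattice_isomorphic:
  assumes "lattice (CD_lattice G)"
  shows "lattice_isomorphic (CD_lattice G) (CD_lattice (G\<lparr>carrier := P\<rparr>))"
proof (rule lattice_isomorphic_if_order [OF assms, where f = "\<lambda>H. H \<inter> P"])
  interpret P: finite_group "G\<lparr>carrier := P\<rparr>" by (rule finite_group_P)
  have Q: "Q \<subseteq> H" "subgroup H G" if "H \<in> CD G" for H
    using QZ center_subset_CD [OF that] CD_subgroup [OF that] by blast+
  have mono: "H \<subseteq> K \<longleftrightarrow> H \<inter> P \<subseteq> K \<inter> P" if "H \<in> CD G" "K \<in> CD G" for H K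
  proof
    assume "H \<inter> P \<subseteq> K \<inter> P"
    then have "(H \<inter> P) <#> Q \<subseteq> (K \<inter> P) <#> Q" by (rule mono_set_mult) simp
    then show "H \<subseteq> K" using decompose(1) Q that by simp
  qed blast
  show "partial_order (CD_lattice (G\<lparr>carrier := P\<rparr>))"
    by unfold_locales (auto simp: CD_lattice_def)
  show "bij_betw (\<lambda>H. H \<inter> P) (carrier (CD_lattice G)) (carrier (CD_lattice (G\<lparr>carrier := P\<rparr>)))"
    unfolding bij_betw_def CD_lattice_def
  proof (intro conjI)
    show "inj_on (\<lambda>H. H \<inter> P) (carrier \<lparr>carrier = CD G, eq = (=), le = (\<subseteq>)\<rparr>)"
      by (rule inj_onI) (simp add: mono set_eq_subset)
    show "(\<lambda>H. H \<inter> P) ` carrier \<lparr>carrier = CD G, eq = (=), le = (\<subseteq>)\<rparr> =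
      carrier \<lparr>carrier = CD (G\<lparr>carrier := P\<rparr>), eq = (=), le = (\<subseteq>)\<rparr>"
    proof (simp, intro subset_antisym subsetI)
      fix K assume "K \<in> (\<lambda>H. H \<inter> P) ` CD G"
      then show "K \<in> CD (G\<lparr>carrier := P\<rparr>)" using CD_decompose Q by auto
    next
      fix K assume K: "K \<in> CD (G\<lparr>carrier := P\<rparr>)"
      have K': "subgroup K G" "K \<subseteq> P" using P.CD_subgroup [OF K] by (simp_all add: subgroup_P_iff)
      note c = compose [OF K']
      have "K <#> Q \<in> CD G" using CD_decompose [OF c(1,3)] c(2) K by simp
      then show "K \<in> (\<lambda>H. H \<inter> P) ` CD G" using c(2) by (intro image_eqI) auto
    qed
  qed
  show "le (CD_lattice G) H K \<longleftrightarrow> le (CD_lattice (G\<lparr>carrier := P\<rparr>)) (H \<inter> P) (K \<inter> P)"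
    if "H \<in> carrier (CD_lattice G)" "K \<in> carrier (CD_lattice G)" for H K
    using mono that by (simp add: CD_lattice_def)
qed

lemma center_P: "center (G\<lparr>carrier := P\<rparr>) = P \<inter> center G"
proof
  show "P \<inter> center G \<subseteq> center (G\<lparr>carrier := P\<rparr>)"
    using subgroup.mem_carrier [OF sP] by (auto simp: center_def centralizer_def)
  show "center (G\<lparr>carrier := P\<rparr>) \<subseteq> P \<inter> center G"
  proof
    fix x assume "x \<in> center (G\<lparr>carrier := P\<rparr>)"
    then have x: "x \<in> P" "x \<in> centralizer G P"
      using subgroup.mem_carrier [OF sP] by (auto simp: center_def centralizer_def)
    moreover have "x \<in> centralizer G Q"
      using Q_commutes [symmetric] subgroup.mem_carrier [OF sP x(1)] by (simp add: centralizer_def)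
    ultimately show "x \<in> P \<inter> center G"
      using centralizer_set_mult [OF sP sQ] PQ by (simp add: center_def)
  qed
qed

end

text \<open>With |G| = p^e m and m prime to p, \<open>Q\<close> is taken to be the set of solutions
  of x^m = 1, a subgroup because it turns out to be central. Comparing prime divisors shows that it
  has order m, so any Sylow p-subgroup is a complement.\<close>

lemma (in cd_projective) sylow_decomposition:
  shows "\<exists>P Q. central_product G P Q \<and> {S. sylow_subgroup p S G} = {P}
    \<and> {H. hall_subgroup {q. prime q \<and> q \<noteq> p} H G} = {Q}"
proof -
  have ord0: "order G \<noteq> 0" using order_gt_0_iff_finite fin by simp
  obtain e m where em: "order G = p ^ e * m" "\<not> p dvd m"
    using multiplicity_decompose' [OF ord0, of p] not_prime_unit p by metis
  have cop: "coprime (p ^ e) m" using em(2) p by (simp add: prime_imp_coprime_nat)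
  have pow_order: "x [^] (p ^ e * m) = \<one>" if "x \<in> carrier G" for x
    using pow_order_eq_1 [OF that] em(1) by simp
  define Q where "Q = {x \<in> carrier G. x [^] m = \<one>}"
  have pow_Q: "x [^] (p ^ e) \<in> Q" if x: "x \<in> carrier G" for x
  proof -
    have "(x [^] (p ^ e)) [^] m = \<one>"
      unfolding nat_pow_pow [OF x] by (rule pow_order [OF x])
    then show ?thesis using x by (simp add: Q_def)
  qed
  have QZ: "Q \<subseteq> center G"
  proof
    fix x assume "x \<in> Q"
    then have x: "x \<in> carrier G" "x [^] m = \<one>" by (auto simp: Q_def)
    \<comment> \<open>From x^m = 1 and m u = p v + 1 it follows that x is the inverse of a power of
      x^p, which is central.\<close>
    obtain u v where uv: "m * u = p * v + 1" using prime_inverse_mod [OF p em(2)] by blast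
    have "\<one> = x [^] (m * u)" using x by (simp flip: nat_pow_pow)
    also have "\<dots> = (x [^] p) [^] v \<otimes> x" unfolding uv using x by (simp flip: nat_pow_pow)
    finally have "inv ((x [^] p) [^] v) = x"
      using x by (metis inv_char inv_equality inv_inv nat_pow_closed)
    moreover have "(x [^] p) [^] v \<in> center G"
      using pow_closed_subgroup [OF center_subgroup pow_p_center [OF x(1)]] .
    ultimately show "x \<in> center G" using subgroup.m_inv_closed [OF center_subgroup] by metis
  qed
  have sQ: "subgroup Q G"
  proof (rule subgroup_if_finite_closed)
    show sub: "Q \<subseteq> carrier G" by (auto simp: Q_def)
    then show "finite Q" by (rule finite_subset) simp
    show "Q \<noteq> {}" by (auto simp: Q_def intro!: exI [of _ \<one>])
    fix x y assume x: "x \<in> Q" and y: "y \<in> Q"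
    have xy: "x \<in> carrier G" "y \<in> carrier G" "x [^] m = \<one>" "y [^] m = \<one>" using x y by (auto simp: Q_def)
    have "x \<otimes> y = y \<otimes> x" using center_commutes x QZ xy(2) by blast
    then have "(x \<otimes> y) [^] m = \<one>" using pow_mult_distrib xy by simp
    then show "x \<otimes> y \<in> Q" using xy by (simp add: Q_def)
  qed
  have indexQ: "card (rcosets Q) * card Q = p ^ e * m" using lagrange [OF sQ] em(1) by simp
  have primes_Q: "r dvd m" if r: "prime r" "r dvd card Q" for r
  proof -
    interpret Q: finite_group "G\<lparr>carrier := Q\<rparr>"
      using subgroup_imp_group [OF sQ] sQ by (simp add: finite_group_def finite_group_axioms_def)
    show ?thesis
    proof (rule Q.prime_dvd_order_dvd_exponent [OF r(1)])
      show "r dvd order (G\<lparr>carrier := Q\<rparr>)" using r(2) by (simp add: order_def)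
      fix x assume "x \<in> carrier (G\<lparr>carrier := Q\<rparr>)"
      then show "x [^]\<^bsub>G\<lparr>carrier := Q\<rparr>\<^esub> m = \<one>\<^bsub>G\<lparr>carrier := Q\<rparr>\<^esub>"
        by (simp add: Q_def flip: nat_pow_consistent)
    qed
  qed
  \<comment> \<open>All p^e-th powers lie in \<open>Q\<close> by \<open>pow_Q\<close>, so the
    exponent of G/Q divides p^e and p is the only possible prime divisor of its order.\<close>
  have primes_index: "r = p" if r: "prime r" "r dvd card (rcosets Q)" for r
  proof -
    have nQ: "Q \<lhd> G"
      using sQ
    proof (rule normal_invI)
      fix x h assume x: "x \<in> carrier G" and h: "h \<in> Q"
      have hG: "h \<in> carrier G" using h by (simp add: Q_def)
      have "x \<otimes> h \<otimes> inv x = h \<otimes> x \<otimes> inv x" using center_commutes [of h x] h QZ x by auto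
      also have "\<dots> = h" using x hG by (simp add: m_assoc)
      finally show "x \<otimes> h \<otimes> inv x \<in> Q" using h by simp
    qed
    then interpret N: normal Q G .
    interpret F: finite_group "G Mod Q"
      using N.factorgroup_is_group by (simp add: finite_group_def finite_group_axioms_def carrier_FactGroup)
    have "r dvd p ^ e"
    proof (rule F.prime_dvd_order_dvd_exponent [OF r(1)])
      show "r dvd order (G Mod Q)" using r(2) by (simp add: order_def FactGroup_def)
      fix X assume "X \<in> carrier (G Mod Q)"
      then obtain x where x: "x \<in> carrier G" "X = Q #> x" by (auto simp: carrier_FactGroup)
      have "x [^] (p ^ e) \<in> Q" using x(1) by (rule pow_Q)
      then have "Q #> x [^] (p ^ e) = Q" using sQ x(1) by (simp add: coset_join2)
      then show "X [^]\<^bsub>G Mod Q\<^esub> (p ^ e) = \<one>\<^bsub>G Mod Q\<^esub>" using x N.FactGroup_pow by simp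
    qed
    then have "r dvd p" using r(1) prime_dvd_power by blast
    then show ?thesis using r(1) p by (simp add: primes_dvd_imp_eq)
  qed
  have cardQ: "card (rcosets Q) = p ^ e" "card Q = m"
  proof -
    have "coprime (card Q) (p ^ e)"
      using primes_Q p em(2) by (intro coprime_if_primes) (metis prime_dvd_power primes_dvd_imp_eq)
    moreover have "coprime (card (rcosets Q)) m"
      using primes_index em(2) by (intro coprime_if_primes) blast
    ultimately show "card (rcosets Q) = p ^ e" "card Q = m"
      using coprime_factorization_unique [OF indexQ] by blast+
  qed
  obtain P where P: "subgroup P G" "card P = p ^ e"
    using sylow_thm [OF p is_group em(1) fin] by blast
  have exponent: "x [^] card H = \<one>" if H: "subgroup H G" "x \<in> H" for H x
  proof -
    interpret H: group "G\<lparr>carrier := H\<rparr>" using H(1) by (rule subgroup_imp_group)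
    show ?thesis using H.pow_order_eq_1 [of x] H(2) by (simp add: order_def nat_pow_consistent [symmetric])
  qed
  have triv: "x = \<one>" if x: "x \<in> carrier G" "x [^] (p ^ e) = \<one>" "x [^] m = \<one>" for x
  proof -
    have "ord x dvd p ^ e" "ord x dvd m" using x by (simp_all add: pow_eq_id)
    then have "ord x = 1" using cop coprime_common_divisor_nat by blast
    then show ?thesis using ord_eq_1 [OF x(1)] by blast
  qed
  have int: "P \<inter> Q = {\<one>}"
  proof
    show "P \<inter> Q \<subseteq> {\<one>}" using triv exponent [OF P(1)] P(2) by (auto simp: Q_def)
    show "{\<one>} \<subseteq> P \<inter> Q" using subgroup.one_closed P(1) sQ by blast
  qed
  have PQ: "P <#> Q = carrier G"
  proof (rule card_subset_eq)
    show "P <#> Q \<subseteq> carrier G" by (rule set_mult_closed [OF subgroup.subset [OF P(1)] subgroup.subset [OF sQ]])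
    show "card (P <#> Q) = card (carrier G)"
      using card_set_mult_Int [OF P(1) sQ] int P(2) cardQ(2) em(1) by (simp add: order_def)
  qed simp
  have cp: "central_product G P Q"
    using P(1) sQ QZ PQ int by (intro central_product.intro central_product_axioms.intro finite_group_axioms)
  have indexP: "card (rcosets P) = m"
    using lagrange [OF P(1)] P(2) em(1) prime_gt_0_nat [OF p] by simp
  have "{S. sylow_subgroup p S G} = {P}"
  proof (intro subset_antisym subsetI)
    fix S assume "S \<in> {S. sylow_subgroup p S G}"
    then obtain a where S: "subgroup S G" "card S = p ^ a" "\<not> p dvd card (rcosets S)"
      by (auto simp: sylow_subgroup_def)
    have "card S = p ^ e"
    proof (rule coprime_factorization_unique(2))
      show "card (rcosets S) * card S = m * p ^ e" using lagrange [OF S(1)] em(1) by (simp add: mult.commute)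
      show "coprime (card S) m" using em(2) p S(2) by (simp add: prime_imp_coprime_nat)
      show "coprime (card (rcosets S)) (p ^ e)"
        using S(3) p by (simp add: prime_imp_coprime_nat coprime_commute)
    qed
    have "S \<subseteq> P"
    proof
      fix s assume s: "s \<in> S"
      then have "s \<in> P <#> Q" using PQ subgroup.mem_carrier [OF S(1)] by blast
      then obtain x q where xq: "s = x \<otimes> q" "x \<in> P" "q \<in> Q" by (auto simp: mem_set_mult)
      have G: "x \<in> carrier G" "q \<in> carrier G"
        using subgroup.mem_carrier [OF P(1) xq(2)] subgroup.mem_carrier [OF sQ xq(3)] .
      have "x \<otimes> q = q \<otimes> x" using center_commutes [of q x] xq(3) QZ G by auto
      \<comment> \<open>The central factor q is isolated: s and x have orders dividing p^e, hence so
        does q, while its order also divides m.\<close>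
      then have "s [^] (p ^ e) = x [^] (p ^ e) \<otimes> q [^] (p ^ e)"
        unfolding xq(1) using G by (rule pow_mult_distrib)
      moreover have "s [^] (p ^ e) = \<one>" using exponent [OF S(1) s] \<open>card S = p ^ e\<close> by simp
      moreover have "x [^] (p ^ e) = \<one>" using exponent [OF P(1) xq(2)] P(2) by simp
      ultimately have "q [^] (p ^ e) = \<one>" using G by simp
      then have "q = \<one>" using triv [OF G(2)] xq(3) by (simp add: Q_def)
      then show "s \<in> P" using xq G by simp
    qed
    then have "S = P" using \<open>card S = p ^ e\<close> P by (simp add: card_subset_eq)
    then show "S \<in> {P}" by simp
  next
    fix S assume "S \<in> {P}"
    then show "S \<in> {S. sylow_subgroup p S G}" using P indexP em(2) by (auto simp: sylow_subgroup_def)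
  qed
  moreover have "{H. hall_subgroup {q. prime q \<and> q \<noteq> p} H G} = {Q}"
  proof (intro subset_antisym subsetI)
    fix H assume "H \<in> {H. hall_subgroup {q. prime q \<and> q \<noteq> p} H G}"
    then have H: "subgroup H G" "\<And>r. prime r \<Longrightarrow> r dvd card H \<Longrightarrow> r \<noteq> p"
      "\<And>r. prime r \<Longrightarrow> r dvd card (rcosets H) \<Longrightarrow> r = p"
      by (auto simp: hall_subgroup_def)
    have "card H = m"
    proof (rule coprime_factorization_unique(2))
      show "card (rcosets H) * card H = p ^ e * m" using lagrange [OF H(1)] em(1) by simp
      show "coprime (card H) (p ^ e)"
        using H(2) p by (intro coprime_if_primes) (metis prime_dvd_power primes_dvd_imp_eq)
      show "coprime (card (rcosets H)) m"
        using H(3) em(2) by (intro coprime_if_primes) blast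
    qed
    have "H \<subseteq> Q"
      using exponent [OF H(1)] \<open>card H = m\<close> subgroup.mem_carrier [OF H(1)] by (auto simp: Q_def)
    then have "H = Q" using \<open>card H = m\<close> cardQ(2) sQ by (simp add: card_subset_eq)
    then show "H \<in> {Q}" by simp
  next
    fix H assume "H \<in> {Q}"
    moreover have "hall_subgroup {q. prime q \<and> q \<noteq> p} Q G"
      using sQ primes_index primes_Q em(2) by (auto simp: hall_subgroup_def)
    ultimately show "H \<in> {H. hall_subgroup {q. prime q \<and> q \<noteq> p} H G}" by simp
  qed
  ultimately show ?thesis using cp by blast
qed

theorem theoremA:
  fixes G :: "('a, 'm) monoid_scheme" and E :: "('b, 'k) monoid_scheme" and p n :: nat
  assumes "group G" and "finite (carrier G)"
    and "carrier G \<in> CD G"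
    and "prime p" and "n \<ge> 2"
    and "elementary_abelian p E" and "order E = p ^ n"
    and "lattice_isomorphic (CD_lattice G) (subgroup_lattice E)"
  shows "\<exists>P Q. {S. sylow_subgroup p S G} = {P}
    \<and> {H. hall_subgroup {q. prime q \<and> q \<noteq> p} H G} = {Q}
    \<and> internal_direct_product G P Q
    \<and> elementary_abelian p (G\<lparr>carrier := P\<rparr> Mod center (G\<lparr>carrier := P\<rparr>))
    \<and> comm_group (G\<lparr>carrier := Q\<rparr>)
    \<and> lattice_isomorphic (CD_lattice G) (CD_lattice (G\<lparr>carrier := P\<rparr>))"
proof -
  interpret cd_projective G p using assms by (rule cd_projectiveI)
  obtain P Q where cp: "central_product G P Q" and unique: "{S. sylow_subgroup p S G} = {P}"
    "{H. hall_subgroup {q. prime q \<and> q \<noteq> p} H G} = {Q}"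
    using sylow_decomposition by blast
  interpret central_product G P Q by fact
  interpret P: finite_group "G\<lparr>carrier := P\<rparr>" by (rule finite_group_P)
  have "elementary_abelian p (G\<lparr>carrier := P\<rparr> Mod center (G\<lparr>carrier := P\<rparr>))"
  proof (rule P.elementary_abelian_Mod_center)
    fix x y assume "x \<in> carrier (G\<lparr>carrier := P\<rparr>)" "y \<in> carrier (G\<lparr>carrier := P\<rparr>)"
    then have xy: "x \<in> P" "y \<in> P" by simp_all
    have G: "x \<in> carrier G" "y \<in> carrier G"
      using subgroup.mem_carrier [OF sP xy(1)] subgroup.mem_carrier [OF sP xy(2)] .
    have "commutator x y \<in> P"
      unfolding commutator_def
      using xy by (simp add: subgroup.m_closed [OF sP] subgroup.m_inv_closed [OF sP])
    then have "commutator x y \<in> center (G\<lparr>carrier := P\<rparr>)"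
      using commutator_center [OF G] by (simp add: center_P)
    then show "\<exists>z\<in>center (G\<lparr>carrier := P\<rparr>).
      x \<otimes>\<^bsub>G\<lparr>carrier := P\<rparr>\<^esub> y = z \<otimes>\<^bsub>G\<lparr>carrier := P\<rparr>\<^esub> (y \<otimes>\<^bsub>G\<lparr>carrier := P\<rparr>\<^esub> x)"
      using commutator_swap [OF G] by auto
  next
    fix x assume "x \<in> carrier (G\<lparr>carrier := P\<rparr>)"
    then have x: "x \<in> P" by simp
    have "x [^]\<^bsub>G\<^esub> p \<in> P \<inter> center G"
      using pow_closed_subgroup [OF sP x] pow_p_center [OF subgroup.mem_carrier [OF sP x]] by simp
    then show "x [^]\<^bsub>G\<lparr>carrier := P\<rparr>\<^esub> p \<in> center (G\<lparr>carrier := P\<rparr>)"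
      by (simp add: center_P nat_pow_consistent [symmetric])
  qed
  moreover have "comm_group (G\<lparr>carrier := Q\<rparr>)"
    using subgroup_imp_group [OF sQ] Q_commutes subgroup.mem_carrier [OF sQ]
    by (intro group.group_comm_groupI) auto
  moreover have "lattice (CD_lattice G)"
    using assms(8) by (auto simp: lattice_isomorphic_def join_pres_def)
  ultimately show ?thesis
    using unique internal_direct_product CD_lattice_isomorphic
    by (intro exI [of _ P] exI [of _ Q] conjI) simp_all
qed

end
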